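(* Let $L=\mathbb{Q}(\sqrt m,\sqrt n)$ be a biquadratic extension of $\mathbb{Q}$ with $m,n$ square-free, $m\equiv1\pmod 4$ and $n\equiv 2$ or $3\pmod 4$. Let $d=\gcd(m,n)$, $k=\frac{mn}{d^2}$, and let $H_1$ be the non-classical Hopf-Galois structure on $L/\mathbb{Q}$ corresponding to $\sqrt m$. Then $\mathcal{O}_L$ is $\mathfrak{A}_{H_1}$-free if and only if there exist integers $x,y\in\mathbb{Z}$ such that at least one of the equations $x^2+my^2=\pm2d$ is satisfied. If it is so, a free generator of $\mathcal{O}_L$ as $\mathfrak{A}_{H_1}$-module is $$\beta=\gamma_1-\gamma_2+\frac{x-dy}{2d}\,\gamma_3+y\,\gamma_4,$$ where $\gamma_1=1,\ \gamma_2=\frac{1+\sqrt m}{2},\ \gamma_3=\sqrt n,\ \gamma_4=\frac{\sqrt n+\sqrt k}{2}$.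
   Context: $L=\mathbb{Q}(\sqrt m,\sqrt n)$ has Galois group $C_2\times C_2$; its quadratic subfields are $\mathbb{Q}(\sqrt m),\mathbb{Q}(\sqrt n),\mathbb{Q}(\sqrt k)$, with $\sqrt k=\sqrt m\sqrt n/d$ and $d=\gcd(m,n)>0$. Here $n\equiv k\pmod 4$ and $\{\gamma_1,\gamma_2,\gamma_3,\gamma_4\}$ is an integral basis of $L$. A Hopf-Galois structure on $L/\mathbb{Q}$ is a finite-dimensional cocommutative $\mathbb{Q}$-Hopf algebra $H$ with an action making $L$ a left $H$-module algebra such that $L\otimes_{\mathbb{Q}} H\to\mathrm{End}_{\mathbb{Q}}(L)$, $x\otimes h\mapsto(y\mapsto x(h\cdot y))$ is bijective. Besides the classical one $\mathbb{Q}[\mathrm{Gal}(L/\mathbb{Q})]$, there are exactly three, one for each $\zeta\in\{\sqrt m,\sqrt n,\sqrt k\}$. Explicitly, let $\tau$ generate $\mathrm{Gal}(L/\mathbb{Q}(\zeta))$ and let $\sigma\in\mathrm{Gal}(L/\mathbb{Q})\setminus\langle\tau\rangle$; since the action is faithful, the structure corresponding to $\zeta$ is identified, as an algebra acting on $L$, with the subalgebra of $\mathrm{End}_{\mathbb{Q}}(L)$ having $\mathbb{Q}$-basis $\mathrm{id},\ \tau,\ \sigma+\sigma\tau,\ \zeta(\sigma-\sigma\tau)$. The associated order is $\mathfrak{A}_H=\{h\in H: h\cdot\mathcal{O}_L\subseteq\mathcal{O}_L\}$; "$\mathcal{O}_L$ is $\mathfrak{A}_H$-free" means free (of rank one) as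 $\mathfrak{A}_H$-module, and a free generator is a $\beta\in\mathcal{O}_L$ such that $\mathfrak{A}_H\to\mathcal{O}_L$, $h\mapsto h\cdot\beta$, is bijective. *)

theory Defs
  imports Complex_Main "HOL-Computational_Algebra.Computational_Algebra"
    "HOL-Algebra.Bij" "HOL-Algebra.Elementary_Groups"
begin

text \<open>
  Number fields are subfields of the complex numbers. Maps from a field \<open>L\<close> to itself are
  represented by functions that are extensional on \<open>L\<close> (\<open>undefined\<close> outside \<open>L\<close>), as in
  \<^const>\<open>Bij\<close>; this makes equality of such functions the same as equality of maps on \<open>L\<close>.
\<close>

definition subfield_of_complex :: "complex set \<Rightarrow> bool" where
  "subfield_of_complex K \<longleftrightarrow>
     0 \<in> K \<and> 1 \<in> K \<and>
     (\<forall>x\<in>K. \<forall>y\<in>K. x + y \<in> K \<and> x * y \<in> K) \<and>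
     (\<forall>x\<in>K. - x \<in> K \<and> inverse x \<in> K)"

definition rat_adjoin :: "complex set \<Rightarrow> complex set" where
  "rat_adjoin S = subfield_of_complex hull S"

definition degree_over_rat :: "complex set \<Rightarrow> nat" where
  "degree_over_rat L = vector_space.dim (\<lambda>(q::rat) (x::complex). of_rat q * x) L"

definition galois_group :: "complex set \<Rightarrow> complex set \<Rightarrow> (complex \<Rightarrow> complex) monoid" where
  "galois_group K L = (BijGroup L)
     \<lparr>carrier := {f \<in> Bij L.
        (\<forall>x\<in>L. \<forall>y\<in>L. f (x + y) = f x + f y \<and> f (x * y) = f x * f y) \<and>
        (\<forall>x\<in>K. f x = x)}\<rparr>"

text \<open>
  The isomorphism gives four automorphisms, so together with the degree it says that \<open>L\<close> is
  Galois over the rationals with group \<open>C\<^sub>2 \<times> C\<^sub>2\<close>.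
\<close>

definition biquadratic :: "complex set \<Rightarrow> bool" where
  "biquadratic L \<longleftrightarrow> subfield_of_complex L \<and> degree_over_rat L = 4 \<and>
     galois_group \<rat> L \<cong> integer_mod_group 2 \<times>\<times> integer_mod_group 2"

definition ring_of_integers :: "complex set \<Rightarrow> complex set" where
  "ring_of_integers L = {x \<in> L. algebraic_int x}"

text \<open>
  The non-classical Hopf-Galois structure on a biquadratic field \<open>L\<close> corresponding to
  \<open>\<zeta>\<close>, where \<open>\<zeta>\<close> is a square root generating a quadratic subfield. A Hopf-Galois structure
  acts faithfully on \<open>L\<close>, so this one is given as an algebra of rational-linear endomorphisms
  of \<open>L\<close>, namely the one with rational basis \<open>id\<close>, \<open>\<tau>\<close>, \<open>\<sigma> + \<sigma>\<tau>\<close>, \<open>\<zeta>(\<sigma> - \<sigma>\<tau>)\<close>, where \<open>\<tau>\<close>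
  generates the Galois group of \<open>L\<close> over \<open>\<rat>(\<zeta>)\<close> and \<open>\<sigma>\<close> is any automorphism outside
  that group. The other choice \<open>\<sigma>\<tau>\<close> of \<open>\<sigma>\<close> only changes the sign of the last basis vector.
\<close>

definition nonclassical_algebra ::
  "complex set \<Rightarrow> complex \<Rightarrow> (complex \<Rightarrow> complex) \<Rightarrow> (complex \<Rightarrow> complex) \<Rightarrow> (complex \<Rightarrow> complex) set" where
  "nonclassical_algebra L \<zeta> \<sigma> \<tau> =
     {\<lambda>x\<in>L. of_rat a * x + of_rat b * \<tau> x + of_rat c * (\<sigma> x + compose L \<sigma> \<tau> x)
            + of_rat e * (\<zeta> * (\<sigma> x - compose L \<sigma> \<tau> x)) | a b c e. True}"

definition nonclassical_hopf_galois ::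
  "complex set \<Rightarrow> complex \<Rightarrow> (complex \<Rightarrow> complex) set \<Rightarrow> bool" where
  "nonclassical_hopf_galois L \<zeta> H \<longleftrightarrow>
     (\<exists>\<sigma> \<tau>. generate (galois_group (rat_adjoin {\<zeta>}) L) {\<tau>}
                = carrier (galois_group (rat_adjoin {\<zeta>}) L) \<and>
            \<sigma> \<in> carrier (galois_group \<rat> L) - carrier (galois_group (rat_adjoin {\<zeta>}) L) \<and>
            H = nonclassical_algebra L \<zeta> \<sigma> \<tau>)"

definition associated_order ::
  "complex set \<Rightarrow> (complex \<Rightarrow> complex) set \<Rightarrow> (complex \<Rightarrow> complex) set" where
  "associated_order L H = {h \<in> H. h ` ring_of_integers L \<subseteq> ring_of_integers L}"

definition free_generator :: "(complex \<Rightarrow> complex) set \<Rightarrow> complex set \<Rightarrow> complex \<Rightarrow> bool" where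
  "free_generator A M \<beta> \<longleftrightarrow> \<beta> \<in> M \<and> bij_betw (\<lambda>h. h \<beta>) A M"

definition free_of_rank_one :: "(complex \<Rightarrow> complex) set \<Rightarrow> complex set \<Rightarrow> bool" where
  "free_of_rank_one A M \<longleftrightarrow> (\<exists>\<beta>. free_generator A M \<beta>)"

end

theory Submission
  imports Defs
begin

text \<open>
  Write \<open>m = d m'\<close> and \<open>n = d n'\<close>. In the basis \<open>1, \<surd>m, \<surd>n, \<surd>k\<close> the Hopf algebra preserves both
  the span of \<open>1, \<surd>m\<close> and that of \<open>\<surd>n, \<surd>k\<close>: it is diagonal on the first and consists of the
  combinations of the identity and \<open>T: \<surd>n \<mapsto> d \<surd>k, \<surd>k \<mapsto> - m' \<surd>n\<close> on the second. As
  \<open>gcd (2 d) ((d + m') / 2) = 1\<close>, the associated order is the product of the orders of both blocks,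
  the second one being spanned by the identity and \<open>T\<close>. An integer with coordinates \<open>A, B, C, D\<close>
  in \<open>\<gamma>\<^sub>1, \<dots>, \<gamma>\<^sub>4\<close> is therefore a free generator iff two integral \<open>2 \<times> 2\<close> determinants are units,
  namely \<open>B (2 A + B)\<close>, and \<open>Q = 2 d C\<^sup>2 + 2 d C D + (d + m') / 2 D\<^sup>2\<close>, for which
  \<open>2 d Q = (d (2 C + D))\<^sup>2 + m D\<^sup>2\<close>.
\<close>

section \<open>Subfields of the complex numbers\<close>

lemma subfield_of_complexD:
  assumes "subfield_of_complex K"
  shows "0 \<in> K" "1 \<in> K" "\<And>x y. x \<in> K \<Longrightarrow> y \<in> K \<Longrightarrow> x + y \<in> K"
    "\<And>x y. x \<in> K \<Longrightarrow> y \<in> K \<Longrightarrow> x * y \<in> K" "\<And>x. x \<in> K \<Longrightarrow> - x \<in> K"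
    "\<And>x. x \<in> K \<Longrightarrow> inverse x \<in> K"
    "\<And>x y. x \<in> K \<Longrightarrow> y \<in> K \<Longrightarrow> x - y \<in> K"
    "\<And>x y. x \<in> K \<Longrightarrow> y \<in> K \<Longrightarrow> x / y \<in> K"
proof -
  show "x - y \<in> K" if "x \<in> K" "y \<in> K" for x y
    using assms that unfolding subfield_of_complex_def by (metis diff_conv_add_uminus)
qed (use assms in \<open>auto simp: subfield_of_complex_def divide_inverse\<close>)

lemma subfield_of_complex_Rats_subset:
  assumes "subfield_of_complex K"
  shows "\<rat> \<subseteq> K"
proof
  note K = subfield_of_complexD[OF assms]
  have nat: "of_nat i \<in> K" for i
    by (induction i) (auto intro: K)
  have int: "of_int i \<in> K" for i
    by (cases i rule: int_cases2) (auto intro: K nat)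
  fix x :: complex
  assume "x \<in> \<rat>"
  then obtain a b where "x = of_int a / of_int b"
    by (auto elim: Rats_cases')
  then show "x \<in> K"
    using K(8) int by auto
qed

lemma subfield_of_complex_Rats: "subfield_of_complex \<rat>"
  by (auto simp: subfield_of_complex_def)

lemma subfield_of_complex_rat_adjoin: "subfield_of_complex (rat_adjoin S)"
  unfolding rat_adjoin_def by (rule hull_in) (auto simp: subfield_of_complex_def)

text \<open>Inverses come from rationalising the denominator. As \<open>s\<close> may already lie in
  \<open>K\<close>, the conjugate \<open>a - b * s\<close> can vanish for a nonzero
  \<open>x\<close>; then \<open>x = 2 * a\<close> lies in \<open>K\<close> and is inverted
  there.\<close>

lemma subfield_of_complex_adjoin_sqrt:
  assumes "subfield_of_complex K" "s\<^sup>2 \<in> K"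
  shows "subfield_of_complex {a + b * s | a b. a \<in> K \<and> b \<in> K}" (is "subfield_of_complex ?F")
proof -
  note K = subfield_of_complexD[OF assms(1)]
  have I: "a + b * s \<in> ?F" if "a \<in> K" "b \<in> K" for a b
    using that by blast
  have add: "x + y \<in> ?F" and mult: "x * y \<in> ?F" if xy: "x \<in> ?F" "y \<in> ?F" for x y
  proof -
    obtain a b a' b' where x: "x = a + b * s" "a \<in> K" "b \<in> K"
      and y: "y = a' + b' * s" "a' \<in> K" "b' \<in> K"
      using xy by blast
    have "x + y = (a + a') + (b + b') * s"
      "x * y = (a * a' + b * b' * s\<^sup>2) + (a * b' + b * a') * s"
      by (auto simp: x y algebra_simps power2_eq_square)
    moreover have "a + a' \<in> K" "b + b' \<in> K" "a * a' + b * b' * s\<^sup>2 \<in> K" "a * b' + b * a' \<in> K"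
      using x y assms(2) by (auto intro: K)
    ultimately show "x + y \<in> ?F" "x * y \<in> ?F"
      using I by (simp_all only:)
  qed
  have minus: "- x \<in> ?F" and inv: "inverse x \<in> ?F" if x: "x \<in> ?F" for x
  proof -
    obtain a b where x: "x = a + b * s" "a \<in> K" "b \<in> K"
      using x by blast
    show "- x \<in> ?F"
      using I[of "- a" "- b"] K(5) x by simp
    show "inverse x \<in> ?F"
    proof (cases "x = 0 \<or> a - b * s = 0")
      case True
      have "x \<in> K"
      proof (cases "x = 0")
        case False
        then have "x = 2 * a"
          using True x by simp
        then show ?thesis
          using K(3)[OF x(2) x(2)] by simp
      qed (use K in auto)
      then show ?thesis
        using I[of "inverse x" 0] K by simp
    next
      case False
      let ?N = "a * a - b * b * s\<^sup>2"
      have N: "?N = x * (a - b * s)"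
        by (simp add: x algebra_simps power2_eq_square)
      then have "?N \<noteq> 0"
        using False by simp
      then have "inverse x = (a - b * s) / ?N"
        using False N by (simp add: field_simps)
      also have "\<dots> = a / ?N + (- b / ?N) * s"
        using \<open>?N \<noteq> 0\<close> by (simp add: diff_divide_distrib)
      finally have "inverse x = a / ?N + (- b / ?N) * s" .
      moreover have "a / ?N \<in> K" "- b / ?N \<in> K"
        using x(2,3) assms(2) by (auto intro!: K)
      ultimately show ?thesis
        using I by (simp only:)
    qed
  qed
  show ?thesis
    unfolding subfield_of_complex_def
    using I[of 0 0] I[of 1 0] add mult minus inv K by simp
qed

lemma rat_adjoin_sqrt:
  assumes "s\<^sup>2 \<in> \<rat>"
  shows "rat_adjoin {s} = {a + b * s | a b. a \<in> \<rat> \<and> b \<in> \<rat>}" (is "_ = ?F")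
proof
  have "s \<in> ?F"
    by (rule CollectI, rule exI[of _ 0], rule exI[of _ 1]) simp
  then show "rat_adjoin {s} \<subseteq> ?F"
    unfolding rat_adjoin_def
    using subfield_of_complex_adjoin_sqrt[OF subfield_of_complex_Rats assms]
    by (intro hull_minimal) auto
  show "?F \<subseteq> rat_adjoin {s}"
  proof
    fix x
    assume "x \<in> ?F"
    then obtain a b where x: "x = a + b * s" "a \<in> \<rat>" "b \<in> \<rat>"
      by blast
    have "s \<in> rat_adjoin {s}"
      unfolding rat_adjoin_def by (rule hull_inc) simp
    then show "x \<in> rat_adjoin {s}"
      using x subfield_of_complex_Rats_subset[OF subfield_of_complex_rat_adjoin, of "{s}"]
        subfield_of_complexD(3,4)[OF subfield_of_complex_rat_adjoin, of _ "{s}"]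
      by blast
  qed
qed

section \<open>Almost integral elements\<close>

text \<open>
  The library does not know that algebraic integers form a ring. Almost integral elements do so
  for trivial reasons, and a rational almost integral number is an integer.
\<close>

definition almost_integral :: "complex set \<Rightarrow> complex \<Rightarrow> bool" where
  "almost_integral R z \<longleftrightarrow> (\<exists>N::int. N > 0 \<and> (\<forall>k. of_int N * z ^ k \<in> R))"

definition subring_of_complex :: "complex set \<Rightarrow> bool" where
  "subring_of_complex R \<longleftrightarrow> 1 \<in> R \<and> (\<forall>x\<in>R. \<forall>y\<in>R. x - y \<in> R \<and> x * y \<in> R)"

context
  fixes R :: "complex set"
  assumes R: "subring_of_complex R"
begin

lemma subring_closed:
  "0 \<in> R" "x \<in> R \<Longrightarrow> - x \<in> R" "x \<in> R \<Longrightarrow> y \<in> R \<Longrightarrow> x + y \<in> R" "x \<in> R \<Longrightarrow> y \<in> R \<Longrightarrow> x * y \<in> R"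
proof -
  have "1 - 1 \<in> R"
    using R unfolding subring_of_complex_def by blast
  then show 0: "0 \<in> R"
    by simp
  have "0 - y \<in> R" if "y \<in> R" for y
    using R 0 that unfolding subring_of_complex_def by blast
  then have minus: "- y \<in> R" if "y \<in> R" for y
    using that by simp
  then show "x \<in> R \<Longrightarrow> - x \<in> R" .
  have "x - - y \<in> R" if "x \<in> R" "y \<in> R"
    using R minus that unfolding subring_of_complex_def by blast
  then show "x \<in> R \<Longrightarrow> y \<in> R \<Longrightarrow> x + y \<in> R"
    by simp
  show "x \<in> R \<Longrightarrow> y \<in> R \<Longrightarrow> x * y \<in> R"
    using R unfolding subring_of_complex_def by blast
qed

lemma subring_of_int: "of_int i \<in> R"
proof -
  have "of_nat j \<in> R" for j
    using R by (induction j) (auto intro: subring_closed simp: subring_of_complex_def)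
  then show ?thesis
    by (cases i rule: int_cases2) (auto intro: subring_closed)
qed

lemma subring_sum: "(\<And>i. i \<in> I \<Longrightarrow> f i \<in> R) \<Longrightarrow> sum f I \<in> R"
  by (induction I rule: infinite_finite_induct) (auto intro: subring_closed)

text \<open>In the binomial expansion the product of the two multipliers clears every monomial,
  independently of how the exponent \<open>k\<close> is split.\<close>

lemma almost_integral_add:
  assumes "almost_integral R x" "almost_integral R y"
  shows "almost_integral R (x + y)"
proof -
  obtain M N :: int where M: "M > 0" "\<And>k. of_int M * x ^ k \<in> R"
    and N: "N > 0" "\<And>k. of_int N * y ^ k \<in> R"
    using assms unfolding almost_integral_def by blast
  have "of_int (M * N) * (x + y) ^ k \<in> R" for k
  proof -
    have "of_int (M * N) * (x + y) ^ k =
        (\<Sum>i\<le>k. of_int (int (k choose i)) * ((of_int M * x ^ i) * (of_int N * y ^ (k - i))))"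
      unfolding binomial_ring sum_distrib_left by (intro sum.cong) (auto simp: mult_ac)
    also have "\<dots> \<in> R"
      by (intro subring_sum subring_closed subring_of_int M N)
    finally show ?thesis .
  qed
  then show ?thesis
    unfolding almost_integral_def using M N by (intro exI[of _ "M * N"]) auto
qed

lemma almost_integral_mult:
  assumes "almost_integral R x" "almost_integral R y"
  shows "almost_integral R (x * y)"
proof -
  obtain M N :: int where M: "M > 0" "\<And>k. of_int M * x ^ k \<in> R"
    and N: "N > 0" "\<And>k. of_int N * y ^ k \<in> R"
    using assms unfolding almost_integral_def by blast
  have "of_int (M * N) * (x * y) ^ k \<in> R" for k
  proof -
    have "of_int (M * N) * (x * y) ^ k = (of_int M * x ^ k) * (of_int N * y ^ k)"
      by (simp add: power_mult_distrib)
    then show ?thesis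
      using subring_closed(4)[OF M(2)[of k] N(2)[of k]] by (simp only:)
  qed
  then show ?thesis
    unfolding almost_integral_def using M N by (intro exI[of _ "M * N"]) auto
qed

text \<open>A monic integral equation of degree \<open>D\<close> expresses each power from
  \<open>x ^ D\<close> on by lower ones, so a common multiplier for the powers below
  \<open>D\<close> serves all of them. The assumption \<open>denom\<close> provides a multiplier for
  each single power.\<close>

lemma algebraic_int_imp_almost_integral:
  assumes "algebraic_int x" and denom: "\<And>k. \<exists>N::int. N > 0 \<and> of_int N * x ^ k \<in> R"
  shows "almost_integral R x"
proof -
  obtain p where p: "lead_coeff p = 1" "\<And>i. coeff p i \<in> \<int>" "poly p x = 0"
    using assms by (auto elim: algebraic_int.cases)
  define D where "D = degree p"
  have "\<exists>N::int. N > 0 \<and> (\<forall>k<j. of_int N * x ^ k \<in> R)" for j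
  proof (induction j)
    case (Suc j)
    then obtain N M :: int where N: "N > 0" "\<forall>k<j. of_int N * x ^ k \<in> R"
      and M: "M > 0" "of_int M * x ^ j \<in> R"
      using denom[of j] by blast
    have "of_int (N * M) * x ^ k \<in> R" if "k < Suc j" for k
    proof (cases "k = j")
      case True
      then show ?thesis
        using subring_closed(4)[OF subring_of_int M(2), of N] by (simp add: mult_ac)
    next
      case False
      then show ?thesis
        using subring_closed(4)[OF subring_of_int, of "of_int N * x ^ k" M] N that
        by (simp add: mult_ac)
    qed
    then show ?case
      using N M by (intro exI[of _ "N * M"]) auto
  qed (auto intro: exI[of _ 1])
  then obtain N :: int where N: "N > 0" "\<And>k. k < D \<Longrightarrow> of_int N * x ^ k \<in> R"
    by blast
  have "of_int N * x ^ k \<in> R" for k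
  proof (induction k rule: less_induct)
    case (less k)
    show ?case
    proof (cases "k < D")
      case False
      \<comment> \<open>The equation is shifted by \<open>x ^ (k - D)\<close>, so that its leading
        term becomes \<open>x ^ k\<close>.\<close>
      have "0 = poly p x * x ^ (k - D)"
        using p by simp
      also have "\<dots> = (\<Sum>i\<le>D. coeff p i * x ^ i * x ^ (k - D))"
        by (simp add: poly_altdef D_def sum_distrib_right)
      also have "\<dots> = (\<Sum>i<D. coeff p i * x ^ i * x ^ (k - D)) + x ^ D * x ^ (k - D)"
        using p(1) by (simp add: D_def flip: lessThan_Suc_atMost)
      also have "x ^ D * x ^ (k - D) = x ^ k"
        using False by (simp flip: power_add)
      finally have "x ^ k = - (\<Sum>i<D. coeff p i * x ^ i * x ^ (k - D))"
        by (simp add: eq_neg_iff_add_eq_0 add.commute)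
      then have "of_int N * x ^ k = - (\<Sum>i<D. coeff p i * (of_int N * x ^ (i + (k - D))))"
        by (simp add: sum_distrib_left mult_ac power_add)
      also have "\<dots> \<in> R"
      proof (intro subring_closed(2) subring_sum, rule subring_closed(4))
        fix i assume "i \<in> {..<D}"
        then show "of_int N * x ^ (i + (k - D)) \<in> R"
          using False by (intro less) auto
        show "coeff p i \<in> R"
          using p(2)[of i] subring_of_int by (auto elim: Ints_cases)
      qed
      finally show ?thesis .
    qed (use N in auto)
  qed
  then show ?thesis
    unfolding almost_integral_def using N by blast
qed

end

text \<open>Every power of the reduced denominator \<open>b\<close> divides the fixed number
  \<open>N\<close>. Since \<open>N < 2 ^ N\<close>, the power with exponent \<open>N\<close> already
  excludes \<open>b \<ge> 2\<close>.\<close>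

lemma almost_integral_rat_imp_Ints:
  fixes q :: rat
  assumes "N > 0" and "\<And>k. of_int N * q ^ k \<in> \<int>"
  shows "q \<in> \<int>"
proof -
  obtain a b where "quotient_of q = (a, b)"
    by force
  then have ab: "b > 0" "coprime a b" "q = of_int a / of_int b"
    by (auto simp: quotient_of_denom_pos quotient_of_coprime quotient_of_div)
  have dvd: "b ^ k dvd N" for k
  proof -
    obtain z where "of_int N * q ^ k = of_int z"
      using assms(2) by (auto elim: Ints_cases)
    then have "of_int (N * a ^ k) = (of_int (z * b ^ k) :: rat)"
      using ab by (simp add: field_simps power_divide)
    then have "N * a ^ k = z * b ^ k"
      by (simp only: of_int_eq_iff)
    then have "b ^ k dvd N * a ^ k"
      by simp
    then show ?thesis
      using ab(2) by (simp add: coprime_dvd_mult_left_iff coprime_commute)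
  qed
  have "b = 1"
  proof (rule ccontr)
    assume "b \<noteq> 1"
    have "N < 2 ^ nat N"
      using of_nat_less_two_power[of "nat N", where 'a = int] assms(1) by simp
    also have "\<dots> \<le> b ^ nat N"
      using \<open>b \<noteq> 1\<close> ab by (intro power_mono) auto
    also have "\<dots> \<le> N"
      using dvd assms(1) by (rule zdvd_imp_le)
    finally show False
      by simp
  qed
  then show ?thesis
    using ab by simp
qed

section \<open>Quadratic integers and integer matrices\<close>

text \<open>The integral quartic \<open>?p\<close> is the norm of the given quadratic: its product
  with the conjugate quadratic, in which \<open>\<gamma>\<close> is replaced by
  \<open>1 - \<gamma>\<close>, the other root of \<open>X^2 - X - g\<close>.\<close>

lemma algebraic_int_quadratic_tower:
  fixes x \<gamma> :: "'a::field_char_0" and g t1 t2 n1 n2 :: int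
  assumes \<gamma>: "\<gamma>\<^sup>2 = \<gamma> + of_int g"
    and x: "x\<^sup>2 + (of_int t1 + of_int t2 * \<gamma>) * x + (of_int n1 + of_int n2 * \<gamma>) = 0"
  shows "algebraic_int x"
proof
  let ?c0 = "n1\<^sup>2 + n1 * n2 - g * n2\<^sup>2" and ?c1 = "2 * t1 * n1 + t1 * n2 + t2 * n1 - 2 * g * t2 * n2"
    and ?c2 = "t1\<^sup>2 + t1 * t2 - g * t2\<^sup>2 + 2 * n1 + n2" and ?c3 = "2 * t1 + t2"
  let ?p = "[:of_int ?c0, of_int ?c1, of_int ?c2, of_int ?c3, 1:] :: 'a poly"
  have g: "of_int g = \<gamma>\<^sup>2 - \<gamma>"
    using \<gamma> by simp
  have "poly ?p x = (x\<^sup>2 + (of_int t1 + of_int t2 * \<gamma>) * x + (of_int n1 + of_int n2 * \<gamma>)) *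
      (x\<^sup>2 + (of_int t1 + of_int t2 * (1 - \<gamma>)) * x + (of_int n1 + of_int n2 * (1 - \<gamma>)))"
    by (simp add: g algebra_simps power2_eq_square)
  then show "poly ?p x = 0"
    using x by simp
  show "lead_coeff ?p = 1"
    by simp
  show "\<forall>i. coeff ?p i \<in> \<int>"
    by (auto simp: coeff_pCons split: nat.splits simp del: of_int_add of_int_mult of_int_diff of_int_power)
qed

text \<open>Squares are 0 or 1 modulo 4. So \<open>U\<close> and \<open>V\<close> have equal parity
  for residue 1, while an odd \<open>V\<close> would make 2 or 3 a square modulo 4 in the other
  cases.\<close>

lemma even_of_norm_mod_4:
  fixes U V D :: int
  assumes "4 dvd U\<^sup>2 - D * V\<^sup>2"
  shows "D mod 4 = 1 \<Longrightarrow> even (U - V)"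
    and "D mod 4 \<in> {2, 3} \<Longrightarrow> even U \<and> even V"
proof -
  have "(U\<^sup>2 - D * V\<^sup>2) mod 4 =
      ((U mod 4)\<^sup>2 - (D mod 4) * (V mod 4)\<^sup>2) mod 4"
    by (intro mod_diff_cong mod_mult_cong) (simp_all add: power_mod)
  then have 0: "((U mod 4)\<^sup>2 - (D mod 4) * (V mod 4)\<^sup>2) mod 4 = 0"
    using assms unfolding dvd_eq_mod_eq_0 by (simp only:)
  define r s where "r = U mod 4" and "s = V mod 4"
  have rs: "r \<in> {0, 1, 2, 3}" "s \<in> {0, 1, 2, 3}"
    unfolding r_def s_def by auto
  have ev: "even W \<longleftrightarrow> W mod 4 = 0 \<or> W mod 4 = 2" for W :: int
    by presburger
  have "even U \<longleftrightarrow> r = 0 \<or> r = 2" "even V \<longleftrightarrow> s = 0 \<or> s = 2"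
    unfolding r_def s_def by (rule ev)+
  then show "D mod 4 = 1 \<Longrightarrow> even (U - V)" "D mod 4 \<in> {2, 3} \<Longrightarrow> even U \<and> even V"
    using 0 rs unfolding r_def[symmetric] s_def[symmetric] even_diff by auto
qed

text \<open>The assumptions say that trace and norm of \<open>u + v * sqrt D\<close> are integers.
  Four times the norm shows that \<open>D * (2 * v)^2\<close> is an integer, so the squared
  denominator of \<open>2 * v\<close> divides the squarefree \<open>D\<close> and is 1. The rest is
  parity modulo 4.\<close>

lemma quadratic_integer_coeffs:
  fixes u v :: rat and D :: int
  assumes "squarefree D" "2 * u \<in> \<int>" "u\<^sup>2 - of_int D * v\<^sup>2 \<in> \<int>"
  shows "D mod 4 = 1 \<Longrightarrow> 2 * v \<in> \<int> \<and> u - v \<in> \<int>"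
    and "D mod 4 \<in> {2, 3} \<Longrightarrow> u \<in> \<int> \<and> v \<in> \<int>"
proof -
  obtain U z where U: "2 * u = of_int U" and z: "u\<^sup>2 - of_int D * v\<^sup>2 = of_int z"
    using assms(2,3) by (auto elim!: Ints_cases)
  obtain a b where "quotient_of (2 * v) = (a, b)"
    by force
  then have ab: "b > 0" "coprime a b" "2 * v = of_int a / of_int b"
    by (auto simp: quotient_of_denom_pos quotient_of_coprime quotient_of_div)
  have "of_int D * (2 * v)\<^sup>2 = (2 * u)\<^sup>2 - 4 * (u\<^sup>2 - of_int D * v\<^sup>2)"
    by (simp add: power2_eq_square algebra_simps)
  then have eq: "of_int D * (2 * v)\<^sup>2 = of_int (U\<^sup>2 - 4 * z)"
    by (simp add: U z)
  then have "of_int (D * a\<^sup>2) = (of_int ((U\<^sup>2 - 4 * z) * b\<^sup>2) :: rat)"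
    using ab(1) unfolding ab(3) by (simp add: field_simps)
  then have "D * a\<^sup>2 = (U\<^sup>2 - 4 * z) * b\<^sup>2"
    by (simp only: of_int_eq_iff)
  then have "b\<^sup>2 dvd D * a\<^sup>2"
    by simp
  then have "b\<^sup>2 dvd D"
    using ab(2) by (simp add: coprime_dvd_mult_left_iff coprime_commute)
  then have "b = 1"
    using squarefreeD[OF assms(1), of b] ab(1) by simp
  then have V: "2 * v = of_int a"
    using ab(3) by simp
  have "of_int (U\<^sup>2 - D * a\<^sup>2) = (of_int (4 * z) :: rat)"
    using eq unfolding V by simp
  then have "U\<^sup>2 - D * a\<^sup>2 = 4 * z"
    by (simp only: of_int_eq_iff)
  then have dvd: "4 dvd U\<^sup>2 - D * a\<^sup>2"
    by simp
  have u: "u = of_int U / 2" and v: "v = of_int a / 2"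
    using U V by simp_all
  show "2 * v \<in> \<int> \<and> u - v \<in> \<int>" if D: "D mod 4 = 1"
  proof -
    obtain i where "U - a = 2 * i"
      using even_of_norm_mod_4(1)[OF dvd D] by (rule evenE)
    then have "u - v = of_int i"
      unfolding u v by (simp add: field_simps flip: of_int_diff)
    then show ?thesis
      by (simp add: V)
  qed
  show "u \<in> \<int> \<and> v \<in> \<int>" if "D mod 4 \<in> {2, 3}"
    using even_of_norm_mod_4(2)[OF dvd that] unfolding u v by auto
qed

lemma bij_int_matrix_iff:
  fixes a b c e :: int
  shows "bij (\<lambda>(x, y). (a * x + b * y, c * x + e * y)) \<longleftrightarrow> \<bar>a * e - b * c\<bar> = 1"
    (is "bij ?f \<longleftrightarrow> \<bar>?\<Delta>\<bar> = 1")
proof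
  assume "bij ?f"
  then have surj: "surj ?f"
    by (rule bij_is_surj)
  \<comment> \<open>The preimages of the standard basis vectors are the columns of an integral right
    inverse, so the determinant divides 1.\<close>
  obtain x y where "?f (x, y) = (1, 0)"
    using surjD[OF surj, of "(1, 0)"] by force
  moreover obtain x' y' where "?f (x', y') = (0, 1)"
    using surjD[OF surj, of "(0, 1)"] by force
  ultimately have eqs: "a * x + b * y = 1" "c * x + e * y = 0" "a * x' + b * y' = 0" "c * x' + e * y' = 1"
    by simp_all
  have "?\<Delta> * (x * y' - x' * y) = (a * x + b * y) * (c * x' + e * y') - (a * x' + b * y') * (c * x + e * y)"
    by (simp add: algebra_simps)
  then have "?\<Delta> dvd 1"
    unfolding eqs by (metis dvd_triv_left diff_zero mult_1 mult_zero_left)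
  then show "\<bar>?\<Delta>\<bar> = 1"
    by simp
next
  assume "\<bar>?\<Delta>\<bar> = 1"
  then have 1: "?\<Delta> * ?\<Delta> = 1"
    by (metis abs_mult_self_eq mult_1)
  \<comment> \<open>A unit determinant is its own inverse, so the inverse matrix is
    \<open>?\<Delta>\<close> times the adjugate.\<close>
  let ?g = "\<lambda>(x, y). (?\<Delta> * (e * x - b * y), ?\<Delta> * (a * y - c * x))"
  have inv: "?g (?f (x, y)) = (x, y)" "?f (?g (x, y)) = (x, y)" for x y
  proof -
    have "?\<Delta> * (e * (a * x + b * y) - b * (c * x + e * y)) = (?\<Delta> * ?\<Delta>) * x"
      "?\<Delta> * (a * (c * x + e * y) - c * (a * x + b * y)) = (?\<Delta> * ?\<Delta>) * y"
      "a * (?\<Delta> * (e * x - b * y)) + b * (?\<Delta> * (a * y - c * x)) = (?\<Delta> * ?\<Delta>) * x"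
      "c * (?\<Delta> * (e * x - b * y)) + e * (?\<Delta> * (a * y - c * x)) = (?\<Delta> * ?\<Delta>) * y"
      by (simp_all add: algebra_simps)
    then show "?g (?f (x, y)) = (x, y)" "?f (?g (x, y)) = (x, y)"
      unfolding 1 by (simp_all only: prod.case mult_1)
  qed
  show "bij ?f"
  proof (rule o_bij[of ?g])
    show "?g \<circ> ?f = id" "?f \<circ> ?g = id"
      unfolding fun_eq_iff split_paired_All o_apply id_apply using inv by blast+
  qed
qed

text \<open>The cofactor \<open>u\<close> of \<open>gcd d x\<close> in \<open>d\<close> also divides
  that gcd, so \<open>u^2\<close> divides \<open>d\<close> and \<open>u\<close> is a unit.\<close>

lemma squarefree_dvd_square_imp_dvd:
  fixes d x :: int
  assumes "squarefree d" "d dvd x\<^sup>2"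
  shows "d dvd x"
proof -
  have "d \<noteq> 0"
    using assms(1) by auto
  then obtain u v where uv: "d = u * gcd d x" "x = v * gcd d x" "coprime u v"
    using gcd_coprime_exists[of d x] by auto
  define e where "e = gcd d x"
  have "e \<noteq> 0"
    using \<open>d \<noteq> 0\<close> by (simp add: e_def)
  have d: "d = u * e" and x: "x = v * e"
    using uv by (simp_all add: e_def)
  have "u * e dvd (e * v\<^sup>2) * e"
    using assms(2) by (simp add: d x power2_eq_square mult_ac)
  then have "u dvd e * v\<^sup>2"
    using \<open>e \<noteq> 0\<close> by simp
  then have "u dvd e"
    using uv(3) by (simp add: coprime_dvd_mult_left_iff)
  then have "u\<^sup>2 dvd d"
    unfolding d power2_eq_square by simp
  then have "u dvd 1"
    by (rule squarefreeD[OF assms(1)])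
  then show ?thesis
    unfolding d x by (metis dvd_mult dvd_refl mult_dvd_mono one_dvd dvd_trans)
qed

lemma bij_map_prod_iff: "bij (map_prod f g) \<longleftrightarrow> bij f \<and> bij g"
proof
  assume "bij (map_prod f g)"
  then have inj: "inj (map_prod f g)" and surj: "surj (map_prod f g)"
    by (auto simp: bij_def)
  have "inj f" "inj g"
    using inj by (auto simp: inj_def)
  moreover have "surj f" "surj g"
    using surj by (auto simp: surj_def)
  ultimately show "bij f \<and> bij g"
    by (simp add: bij_def)
qed (simp add: bij_def prod.inj_map map_prod_surj)

section \<open>The biquadratic field\<close>

text \<open>In the notation of the paper, \<open>m\<close> is \<open>d * m'\<close>, \<open>n\<close> is \<open>d * n'\<close> and \<open>k\<close> is \<open>m' * n'\<close>.\<close>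

locale biquadratic_field =
  fixes d m' n' :: int and sm sn sk :: complex and L :: "complex set"
  assumes squarefree_m: "squarefree (d * m')" and squarefree_n: "squarefree (d * n')"
    and m_mod_4: "(d * m') mod 4 = 1" and n_mod_4: "(d * n') mod 4 \<in> {2, 3}"
    and d_pos: "d > 0" and coprime_m'_n': "coprime m' n'"
    and sm_sq: "sm\<^sup>2 = of_int (d * m')" and sn_sq: "sn\<^sup>2 = of_int (d * n')"
    and sk_eq: "sk = sm * sn / of_int d"
    and L_def: "L = rat_adjoin {sm, sn}" and biquadratic_L: "biquadratic L"
begin

section \<open>Coordinates and multiplication table\<close>

definition elt :: "rat \<Rightarrow> rat \<Rightarrow> rat \<Rightarrow> rat \<Rightarrow> complex" where
  "elt a b c e = of_rat a + of_rat b * sm + of_rat c * sn + of_rat e * sk"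

lemma elt_alt: "elt a b c e = (of_rat a + of_rat b * sm) + (of_rat c + of_rat (e / of_int d) * sm) * sn"
  unfolding elt_def unfolding sk_eq by (simp add: of_rat_divide algebra_simps)

lemma sqrt_mult:
  "sm * sm = of_int (d * m')" "sn * sn = of_int (d * n')" "sk * sk = of_int (m' * n')"
  "sm * sn = of_int d * sk" "sm * sk = of_int m' * sn" "sn * sk = of_int n' * sm"
proof -
  show *: "sm * sm = of_int (d * m')" "sn * sn = of_int (d * n')" "sm * sn = of_int d * sk"
    using sm_sq sn_sq sk_eq d_pos by (auto simp: power2_eq_square)
  have d: "of_int d \<noteq> (0::complex)"
    using d_pos by simp
  have "of_int d * (sm * sk) = (sm * sm) * sn" "of_int d * (sn * sk) = sm * (sn * sn)"
    "of_int d * of_int d * (sk * sk) = (sm * sm) * (sn * sn)"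
    using d_pos by (simp_all add: sk_eq)
  then show "sm * sk = of_int m' * sn" "sn * sk = of_int n' * sm" "sk * sk = of_int (m' * n')"
    using d by (simp_all add: * mult_ac)
qed

lemma elt_add: "elt a b c e + elt a' b' c' e' = elt (a + a') (b + b') (c + c') (e + e')"
  and elt_diff: "elt a b c e - elt a' b' c' e' = elt (a - a') (b - b') (c - c') (e - e')"
  by (simp_all add: elt_def of_rat_add of_rat_diff algebra_simps)

lemma elt_mult: "elt a b c e * elt a' b' c' e' =
    elt (a * a' + of_int (d * m') * b * b' + of_int (d * n') * c * c' + of_int (m' * n') * e * e')
      (a * b' + b * a' + of_int n' * (c * e' + e * c'))
      (a * c' + c * a' + of_int m' * (b * e' + e * b'))
      (a * e' + e * a' + of_int d * (b * c' + c * b'))"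
proof -
  have "elt a b c e * elt a' b' c' e' =
    of_rat (a * a') + of_rat (b * b') * (sm * sm) + of_rat (c * c') * (sn * sn)
      + of_rat (e * e') * (sk * sk)
      + of_rat (a * b' + b * a') * sm + of_rat (c * e' + e * c') * (sn * sk)
      + of_rat (a * c' + c * a') * sn + of_rat (b * e' + e * b') * (sm * sk)
      + of_rat (a * e' + e * a') * sk + of_rat (b * c' + c * b') * (sm * sn)"
    by (simp add: elt_def of_rat_add of_rat_mult algebra_simps)
  also have "\<dots> = elt (a * a' + of_int (d * m') * b * b' + of_int (d * n') * c * c' + of_int (m' * n') * e * e')
      (a * b' + b * a' + of_int n' * (c * e' + e * c'))
      (a * c' + c * a' + of_int m' * (b * e' + e * b'))
      (a * e' + e * a' + of_int d * (b * c' + c * b'))"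
    unfolding sqrt_mult elt_def by (simp add: of_rat_add of_rat_mult algebra_simps)
  finally show ?thesis .
qed

lemma of_rat_eq_elt: "of_rat a = elt a 0 0 0"
  and of_rat_mult_elt: "of_rat q * elt a b c e = elt (q * a) (q * b) (q * c) (q * e)"
  and one_eq_elt: "1 = elt 1 0 0 0" and sm_eq_elt: "sm = elt 0 1 0 0"
  by (simp_all add: elt_def of_rat_mult algebra_simps)

section \<open>The tower of quadratic extensions\<close>

definition K :: "complex set" where
  "K = {a + b * sm | a b. a \<in> \<rat> \<and> b \<in> \<rat>}"

lemma K_eq: "K = rat_adjoin {sm}"
  unfolding K_def by (rule rat_adjoin_sqrt[symmetric]) (simp add: sm_sq)

lemma subfield_K: "subfield_of_complex K"
  unfolding K_eq by (rule subfield_of_complex_rat_adjoin)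

lemma subfield_L: "subfield_of_complex L"
  unfolding L_def by (rule subfield_of_complex_rat_adjoin)

lemma elt_in_L: "elt a b c e \<in> L"
proof -
  have "sm \<in> L" "sn \<in> L"
    unfolding L_def rat_adjoin_def by (rule hull_inc, simp)+
  moreover have "of_rat q \<in> L" "of_int i \<in> L" for q i
    using subfield_of_complex_Rats_subset[OF subfield_L] by auto
  ultimately show ?thesis
    unfolding elt_alt by (intro subfield_of_complexD(3,4)[OF subfield_L])
qed

lemma in_L: "of_rat q \<in> L" "sm \<in> L" "sn \<in> L" "sk \<in> L"
  using elt_in_L[of q 0 0 0] elt_in_L[of 0 1 0 0] elt_in_L[of 0 0 1 0] elt_in_L[of 0 0 0 1]
  by (simp_all add: elt_def)

lemma L_eq_adjoin: "L = {\<alpha> + \<beta> * sn | \<alpha> \<beta>. \<alpha> \<in> K \<and> \<beta> \<in> K}" (is "L = ?F")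
proof
  note K = subfield_of_complexD[OF subfield_K]
  have Rats: "\<rat> \<subseteq> K"
    by (rule subfield_of_complex_Rats_subset[OF subfield_K])
  have "sm \<in> K"
    unfolding K_eq rat_adjoin_def by (rule hull_inc) simp
  then have "sm + 0 * sn \<in> ?F" "0 + 1 * sn \<in> ?F"
    using K by blast+
  moreover have "sn\<^sup>2 \<in> K"
    using Rats by (auto simp: sn_sq simp del: of_int_mult)
  ultimately show "L \<subseteq> ?F"
    unfolding L_def rat_adjoin_def using subfield_of_complex_adjoin_sqrt[OF subfield_K]
    by (intro hull_minimal) auto
  have "K \<subseteq> L" and "sn \<in> L"
    unfolding K_eq L_def rat_adjoin_def by (auto intro: hull_mono[THEN subsetD] hull_inc)
  then show "?F \<subseteq> L"
    by (auto intro!: subfield_of_complexD(3,4)[OF subfield_L])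
qed

lemma L_E:
  assumes "x \<in> L"
  obtains a b c e where "x = elt a b c e"
proof -
  obtain a b c e where "a \<in> \<rat>" "b \<in> \<rat>" "c \<in> \<rat>" "e \<in> \<rat>" "x = (a + b * sm) + (c + e * sm) * sn"
    using assms unfolding L_eq_adjoin K_def by blast
  then obtain a b c e where "x = (of_rat a + of_rat b * sm) + (of_rat c + of_rat e * sm) * sn"
    by (auto elim!: Rats_cases)
  also have "\<dots> = of_rat a + of_rat b * sm + of_rat c * sn + of_rat e * (sm * sn)"
    by (simp add: algebra_simps)
  also have "\<dots> = elt a b c (e * of_int d)"
    unfolding sqrt_mult by (simp add: elt_def of_rat_mult)
  finally show ?thesis ..
qed

text \<open>This is how degree four enters: if \<open>sm\<close> were rational or \<open>sn\<close>
  were in \<open>K\<close>, two elements would span \<open>L\<close> over the rationals.\<close>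

lemma not_spanned_by_two: "\<not> L \<subseteq> {of_rat p * u + of_rat q * v | p q. True}"
proof
  assume sub: "L \<subseteq> {of_rat p * u + of_rat q * v | p q. True}"
  interpret V: vector_space "\<lambda>(q::rat) (x::complex). of_rat q * x"
    by unfold_locales (auto simp: algebra_simps of_rat_add of_rat_mult)
  have "L \<subseteq> V.span {u, v}"
  proof
    fix x
    assume "x \<in> L"
    then obtain p q where "x = of_rat p * u + of_rat q * v"
      using sub by blast
    then show "x \<in> V.span {u, v}"
      by (auto intro!: V.span_add V.span_scale intro: V.span_base)
  qed
  then have "V.dim L \<le> card {u, v}"
    by (intro V.dim_le_card) auto
  also have "\<dots> \<le> 2"
    by (simp add: card_insert_if)
  finally show False
    using biquadratic_L by (simp add: biquadratic_def degree_over_rat_def)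
qed

lemma sm_notin_Rats: "sm \<notin> \<rat>"
proof
  assume "sm \<in> \<rat>"
  then obtain q where q: "sm = of_rat q"
    by (auto elim: Rats_cases)
  have "elt a b c e \<in> {of_rat p * 1 + of_rat q * sn | p q. True}" for a b c e
  proof -
    have "elt a b c e = of_rat (a + b * q) * 1 + of_rat (c + e * q / of_int d) * sn"
      unfolding elt_alt by (simp add: q of_rat_add of_rat_mult of_rat_divide algebra_simps)
    then show ?thesis
      by blast
  qed
  then show False
    using not_spanned_by_two[of 1 sn] by (blast elim: L_E)
qed

lemma sn_notin_K: "sn \<notin> K"
proof
  assume "sn \<in> K"
  then have "L \<subseteq> K"
    unfolding L_eq_adjoin using subfield_of_complexD(3,4)[OF subfield_K] by auto
  moreover have "K \<subseteq> {of_rat p * 1 + of_rat q * sm | p q. True}"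
    unfolding K_def by (auto elim!: Rats_cases)
  ultimately show False
    using not_spanned_by_two[of 1 sm] by (meson subset_trans)
qed

text \<open>Independence is checked along the tower: \<open>1, sn\<close> over \<open>K\<close>
  because \<open>sn\<close> is not in \<open>K\<close>, then \<open>1, sm\<close> over the rationals
  because \<open>sm\<close> is irrational.\<close>

lemma elt_eq_0_iff: "elt a b c e = 0 \<longleftrightarrow> a = 0 \<and> b = 0 \<and> c = 0 \<and> e = 0"
proof
  assume 0: "elt a b c e = 0"
  have sm0: "p = 0 \<and> q = 0" if "of_rat p + of_rat q * sm = 0" for p q
  proof -
    have "q = 0"
    proof (rule ccontr)
      assume "q \<noteq> 0"
      then have "sm = of_rat (- p / q)"
        using that by (simp add: of_rat_divide of_rat_minus field_simps add_eq_0_iff)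
      then show False
        using sm_notin_Rats by auto
    qed
    then show ?thesis
      using that by simp
  qed
  define \<alpha> \<beta> where "\<alpha> = of_rat a + of_rat b * sm" and "\<beta> = of_rat c + of_rat (e / of_int d) * sm"
  have eq: "\<alpha> + \<beta> * sn = 0"
    using 0 by (simp add: \<alpha>_def \<beta>_def elt_alt)
  have "\<alpha> \<in> K" "\<beta> \<in> K"
    unfolding \<alpha>_def \<beta>_def K_def by (force intro: Rats_of_rat)+
  have "\<beta> = 0"
  proof (rule ccontr)
    assume "\<beta> \<noteq> 0"
    then have "sn = - \<alpha> / \<beta>"
      using eq by (simp add: field_simps add_eq_0_iff)
    also have "\<dots> \<in> K"
      using \<open>\<alpha> \<in> K\<close> \<open>\<beta> \<in> K\<close> by (intro subfield_of_complexD[OF subfield_K])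
    finally show False
      using sn_notin_K by simp
  qed
  then have "\<alpha> = 0"
    using eq by simp
  then show "a = 0 \<and> b = 0 \<and> c = 0 \<and> e = 0"
    using \<open>\<beta> = 0\<close> sm0[of a b] sm0[of c "e / of_int d"] d_pos by (simp add: \<alpha>_def \<beta>_def)
qed (simp add: elt_def)

lemma elt_eq_iff: "elt a b c e = elt a' b' c' e' \<longleftrightarrow> a = a' \<and> b = b' \<and> c = c' \<and> e = e'"
  using elt_eq_0_iff[of "a - a'" "b - b'" "c - c'" "e - e'"] by (simp flip: elt_diff)

section \<open>Automorphisms\<close>

lemma galois_group_simps:
  "f \<in> carrier (galois_group F L) \<longleftrightarrow> f \<in> Bij L \<and>
    (\<forall>x\<in>L. \<forall>y\<in>L. f (x + y) = f x + f y \<and> f (x * y) = f x * f y) \<and> (\<forall>x\<in>F. f x = x)"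
  "\<one>\<^bsub>galois_group F L\<^esub> = (\<lambda>x\<in>L. x)"
  "f \<in> Bij L \<Longrightarrow> g \<in> Bij L \<Longrightarrow> f \<otimes>\<^bsub>galois_group F L\<^esub> g = compose L f g"
  by (auto simp: galois_group_def BijGroup_def)

lemma galois_sqrt:
  assumes f: "f \<in> carrier (galois_group \<rat> L)" and "s \<in> L" "s\<^sup>2 \<in> \<rat>"
  shows "f s = s \<or> f s = - s"
proof -
  have "f (s * s) = f s * f s" "f (s\<^sup>2) = s\<^sup>2"
    using f[unfolded galois_group_simps] assms(2,3) by blast+
  then have "(f s)\<^sup>2 = s\<^sup>2"
    by (simp add: power2_eq_square)
  then show ?thesis
    by (simp add: power2_eq_iff)
qed

text \<open>The relation \<open>sm * sn = d * sk\<close> forces the sign at \<open>sk\<close> to be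
  the product of the signs at \<open>sm\<close> and \<open>sn\<close>.\<close>

lemma galois_elt:
  assumes f: "f \<in> carrier (galois_group \<rat> L)" and "f sm = of_rat s * sm" "f sn = of_rat t * sn"
  shows "f (elt a b c e) = elt a (s * b) (t * c) (s * t * e)"
proof -
  have add: "f (x + y) = f x + f y" and mult: "f (x * y) = f x * f y" if "x \<in> L" "y \<in> L" for x y
    using f that by (auto simp: galois_group_simps)
  have fix_rat: "f (of_rat q) = of_rat q" for q
    using f by (auto simp: galois_group_simps)
  note L = in_L
  note closed = subfield_of_complexD(3,4)[OF subfield_L]
  have "f (sm * sn) = of_rat s * sm * (of_rat t * sn)"
    using mult L assms(2,3) by simp
  moreover have "f (of_rat (of_int d) * sk) = of_rat (of_int d) * f sk"
    using mult L fix_rat by metis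
  ultimately have "of_int d * f sk = of_rat s * sm * (of_rat t * sn)"
    by (simp add: sqrt_mult(4))
  also have "\<dots> = of_rat (s * t) * (sm * sn)"
    by (simp add: of_rat_mult)
  finally have "of_int d * f sk = of_rat (s * t) * (sm * sn)" .
  then have sk: "f sk = of_rat (s * t) * sk"
    using d_pos unfolding sqrt_mult(4) by simp
  have "f (elt a b c e) = f (of_rat a) + f (of_rat b * sm) + f (of_rat c * sn) + f (of_rat e * sk)"
    unfolding elt_def by (simp only: add closed L)
  also have "\<dots> = of_rat a + of_rat b * f sm + of_rat c * f sn + of_rat e * f sk"
    by (simp only: mult closed L fix_rat)
  also have "\<dots> = elt a (s * b) (t * c) (s * t * e)"
    unfolding elt_def sk assms(2,3) by (simp add: of_rat_mult)
  finally show ?thesis .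
qed

lemma galois_signs:
  assumes "f \<in> carrier (galois_group \<rat> L)"
  obtains s t where "s \<in> {1, -1::rat}" "t \<in> {1, -1::rat}" "f sm = of_rat s * sm" "f sn = of_rat t * sn"
proof -
  have "f sm = sm \<or> f sm = - sm" "f sn = sn \<or> f sn = - sn"
    using galois_sqrt[OF assms] in_L by (simp_all add: sm_sq sn_sq)
  then have "\<exists>s\<in>{1, -1}. f sm = of_rat s * sm" "\<exists>t\<in>{1, -1}. f sn = of_rat t * sn"
    by (auto simp: of_rat_minus)
  then show ?thesis
    using that by blast
qed

lemma galois_eqI:
  assumes "f \<in> carrier (galois_group \<rat> L)" "g \<in> carrier (galois_group \<rat> L)"
    and "f sm = g sm" "f sn = g sn"
  shows "f = g"
proof (rule extensionalityI[of _ L])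
  show "f \<in> extensional L" "g \<in> extensional L"
    using assms by (auto simp: galois_group_simps Bij_def)
  obtain s t where st: "f sm = of_rat s * sm" "f sn = of_rat t * sn"
    using galois_signs[OF assms(1)] by blast
  fix x
  assume "x \<in> L"
  then obtain a b c e where "x = elt a b c e"
    by (rule L_E)
  then show "f x = g x"
    using galois_elt[OF assms(1) st] galois_elt[OF assms(2), of s t] st assms(3,4) by simp
qed

text \<open>Two signs determine an automorphism, and the Galois group has four elements.\<close>

lemma galois_exists:
  assumes "s \<in> {1, -1}" "t \<in> {1, -1}"
  obtains f where "f \<in> carrier (galois_group \<rat> L)" "f sm = of_rat s * sm" "f sn = of_rat t * sn"
proof -
  let ?G = "carrier (galois_group \<rat> L)"
  let ?r = "\<lambda>f. (f sm, f sn)"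
  let ?S = "{sm, - sm} \<times> {sn, - sn}"
  have "card ?G = card (carrier (integer_mod_group 2 \<times>\<times> integer_mod_group 2))"
    using biquadratic_L unfolding biquadratic_def by (intro iso_same_card) blast
  also have "\<dots> = 4"
    by (simp add: DirProd_def carrier_integer_mod_group card_cartesian_product)
  finally have card: "card ?G = 4" .
  have sub: "?r ` ?G \<subseteq> ?S"
  proof
    fix z
    assume "z \<in> ?r ` ?G"
    then obtain f where "f \<in> ?G" "z = ?r f"
      by blast
    moreover obtain s t where "s \<in> {1, -1::rat}" "t \<in> {1, -1::rat}"
        "f sm = of_rat s * sm" "f sn = of_rat t * sn"
      using galois_signs[OF \<open>f \<in> ?G\<close>] .
    ultimately show "z \<in> ?S"
      by (auto simp: of_rat_minus)
  qed
  have "inj_on ?r ?G"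
    by (auto intro!: inj_onI galois_eqI)
  then have "card (?r ` ?G) = 4"
    using card by (simp add: card_image)
  \<comment> \<open>There are at most four pairs of signed roots, so the injection of the four
    automorphisms into them is onto.\<close>
  moreover have "card ?S \<le> 2 * 2"
    unfolding card_cartesian_product by (intro mult_le_mono) (auto simp: card_insert_if)
  ultimately have "?r ` ?G = ?S"
    using sub by (intro card_seteq) auto
  moreover have "(of_rat s * sm, of_rat t * sn) \<in> ?S"
    using assms by (auto simp: of_rat_minus)
  ultimately have "(of_rat s * sm, of_rat t * sn) \<in> ?r ` ?G"
    by simp
  then show ?thesis
    using that by auto
qed

section \<open>The ring of integers\<close>

lemma odd_d_m': "odd d" "odd m'"
proof -
  have "4 dvd d * m' - 1"
    using m_mod_4 by (simp flip: mod_eq_dvd_iff)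
  then have "even (d * m' - 1)"
    by (rule dvd_trans[rotated]) simp
  then show "odd d" "odd m'"
    by auto
qed

lemma d_mod_4: "d mod 4 = 1 \<and> m' mod 4 = 1 \<or> d mod 4 = 3 \<and> m' mod 4 = 3"
proof -
  have "d mod 4 = 1 \<or> d mod 4 = 3" "m' mod 4 = 1 \<or> m' mod 4 = 3"
    using odd_d_m' by presburger+
  moreover have "(d mod 4) * (m' mod 4) mod 4 = 1"
    using m_mod_4 by (simp add: mod_mult_eq)
  ultimately show ?thesis
    by auto
qed

text \<open>The coefficient of \<open>D^2\<close> in the form \<open>Q\<close>. It is an odd
  integer, because \<open>d\<close> and \<open>m'\<close> are odd and congruent modulo 4.\<close>

definition g :: int where
  "g = (d + m') div 2"

lemma two_g: "2 * g = d + m'" and odd_g: "odd g"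
proof -
  have "(d mod 4 + m' mod 4) mod 4 = 2"
    using d_mod_4 by auto
  then have "(d + m') mod 4 = 2"
    by (simp add: mod_add_eq)
  then show "2 * g = d + m'" "odd g"
    unfolding g_def by presburger+
qed

lemma of_int_g: "of_int g = (of_int d + of_int m') / (2 :: rat)"
  using arg_cong[OF two_g, of "of_int :: int \<Rightarrow> rat"] by simp

text \<open>The order spanned by \<open>1, sm, sn, sk\<close>. Every element of \<open>L\<close> has
  an integer multiple in it, which makes it a suitable base ring for almost integrality.\<close>

definition int_elts :: "complex set" where
  "int_elts = {elt (of_int a) (of_int b) (of_int c) (of_int e) | a b c e. True}"

lemma elt_in_int_elts_iff: "elt a b c e \<in> int_elts \<longleftrightarrow> a \<in> \<int> \<and> b \<in> \<int> \<and> c \<in> \<int> \<and> e \<in> \<int>"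
  unfolding int_elts_def by (auto simp: elt_eq_iff elim!: Ints_cases)

lemma subring_int_elts: "subring_of_complex int_elts"
  unfolding subring_of_complex_def
proof (intro conjI ballI)
  show "1 \<in> int_elts"
    by (subst one_eq_elt) (simp add: elt_in_int_elts_iff)
  fix x y
  assume "x \<in> int_elts" "y \<in> int_elts"
  then obtain a b c e a' b' c' e' where
    x: "x = elt (of_int a) (of_int b) (of_int c) (of_int e)" and
    y: "y = elt (of_int a') (of_int b') (of_int c') (of_int e')"
    unfolding int_elts_def by blast
  show "x - y \<in> int_elts" "x * y \<in> int_elts"
    unfolding x y elt_diff elt_mult elt_in_int_elts_iff by auto
qed

lemma algebraic_int_imp_almost_integral_elt:
  assumes "algebraic_int x" "x \<in> L"
  shows "almost_integral int_elts x"
proof (rule algebraic_int_imp_almost_integral[OF subring_int_elts assms(1)])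
  fix k
  have "x ^ k \<in> L"
    by (induction k) (use assms(2) subfield_of_complexD[OF subfield_L] in auto)
  then obtain a b c e where x: "x ^ k = elt a b c e"
    by (rule L_E)
  have "\<exists>N z. N > 0 \<and> of_int N * q = of_int z" for q :: rat
  proof -
    obtain p r where "quotient_of q = (p, r)"
      by force
    then have "r > 0" "q = of_int p / of_int r"
      by (auto simp: quotient_of_denom_pos quotient_of_div)
    then show ?thesis
      by (intro exI[of _ r] exI[of _ p]) simp
  qed
  then obtain N1 N2 N3 N4 z1 z2 z3 z4 where N: "N1 > 0" "N2 > 0" "N3 > 0" "N4 > 0"
    "of_int N1 * a = of_int z1" "of_int N2 * b = of_int z2"
    "of_int N3 * c = of_int z3" "of_int N4 * e = of_int z4"
    by metis
  let ?N = "N1 * N2 * N3 * N4"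
  have "of_int ?N * a = of_int (N2 * N3 * N4 * z1)" "of_int ?N * b = of_int (N1 * N3 * N4 * z2)"
    "of_int ?N * c = of_int (N1 * N2 * N4 * z3)" "of_int ?N * e = of_int (N1 * N2 * N3 * z4)"
    unfolding of_int_mult N(5-8)[symmetric] by (simp_all only: mult_ac)
  then have "of_rat (of_int ?N) * x ^ k \<in> int_elts"
    unfolding x of_rat_mult_elt elt_in_int_elts_iff using Ints_of_int by metis
  then show "\<exists>N::int. N > 0 \<and> of_int N * x ^ k \<in> int_elts"
    using N(1-4) by (intro exI[of _ ?N]) (simp del: of_int_mult)
qed

lemma almost_integral_rat_elt:
  assumes "almost_integral int_elts (elt q 0 0 0)"
  shows "q \<in> \<int>"
proof -
  obtain N :: int where N: "N > 0" "\<And>k. of_int N * elt q 0 0 0 ^ k \<in> int_elts"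
    using assms unfolding almost_integral_def by blast
  have "of_int N * q ^ k \<in> \<int>" for k
  proof -
    have "of_int N * elt q 0 0 0 ^ k = elt (of_int N * q ^ k) 0 0 0"
      by (simp add: of_rat_mult of_rat_power flip: of_rat_eq_elt)
    then show ?thesis
      using N(2)[of k] elt_in_int_elts_iff by simp
  qed
  with N(1) show ?thesis
    by (rule almost_integral_rat_imp_Ints)
qed

text \<open>An automorphism maps \<open>int_elts\<close> into itself and commutes with powers and
  integer multiples, so the multiplier of an element also serves its conjugates.\<close>

lemma almost_integral_conj:
  assumes "almost_integral int_elts (elt a b c e)" "s \<in> {1, -1}" "t \<in> {1, -1}"
  shows "almost_integral int_elts (elt a (s * b) (t * c) (s * t * e))"
proof -
  obtain f where f: "f \<in> carrier (galois_group \<rat> L)" "f sm = of_rat s * sm" "f sn = of_rat t * sn"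
    using galois_exists[OF assms(2,3)] .
  let ?x = "elt a b c e"
  have mult: "f (x * y) = f x * f y" if "x \<in> L" "y \<in> L" for x y
    using f(1) that by (auto simp: galois_group_simps)
  have fix_rat: "f x = x" if "x \<in> \<rat>" for x
    using f(1) that by (auto simp: galois_group_simps)
  have f_int: "f y \<in> int_elts" if yI: "y \<in> int_elts" for y
  proof -
    obtain a b c e where y: "y = elt (of_int a) (of_int b) (of_int c) (of_int e)"
      using yI unfolding int_elts_def by blast
    show ?thesis
      unfolding y galois_elt[OF f] elt_in_int_elts_iff using assms(2,3) by auto
  qed
  have pow: "?x ^ k \<in> L \<and> f (?x ^ k) = f ?x ^ k" for k
  proof (induction k)
    case 0
    show ?case
      using fix_rat[of 1] subfield_of_complexD(2)[OF subfield_L] by simp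
  next
    case (Suc k)
    then show ?case
      using subfield_of_complexD(4)[OF subfield_L elt_in_L[of a b c e], of "?x ^ k"]
        mult[OF elt_in_L[of a b c e], of "?x ^ k"] by simp
  qed
  have "f (of_int N * ?x ^ k) = of_int N * f ?x ^ k" for N k
    using mult[of "of_int N" "?x ^ k"] in_L(1)[of "of_int N"] fix_rat[of "of_int N"] pow[of k] by simp
  then show ?thesis
    using assms(1) f_int galois_elt[OF f] unfolding almost_integral_def by metis
qed

text \<open>Meant for an element and its conjugate, whose trace and norm then are integers. The
  trace is written \<open>2 * u\<close> to fit \<open>quadratic_integer_coeffs\<close>.\<close>

lemma almost_integral_quadratic:
  assumes "almost_integral int_elts x" "almost_integral int_elts y"
    and "x + y = elt (2 * u) 0 0 0" "x * y = elt w 0 0 0"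
  shows "2 * u \<in> \<int>" "w \<in> \<int>"
  using almost_integral_add[OF subring_int_elts assms(1,2)] almost_integral_mult[OF subring_int_elts assms(1,2)]
  unfolding assms(3,4) by (auto intro: almost_integral_rat_elt)

section \<open>Necessary conditions on the coordinates of an integer\<close>

lemma almost_integral_K:
  assumes ai: "almost_integral int_elts (elt u v 0 0)"
  shows "2 * v \<in> \<int> \<and> u - v \<in> \<int>"
proof -
  have "almost_integral int_elts (elt u (- v) 0 0)"
    using almost_integral_conj[OF ai, of "-1" 1] by simp
  note 1 = almost_integral_quadratic[OF ai this, of u "u\<^sup>2 - of_int (d * m') * v\<^sup>2"]
  show ?thesis
    by (rule quadratic_integer_coeffs(1)[OF squarefree_m _ _ m_mod_4])
      (use 1 in \<open>simp_all add: elt_add elt_mult power2_eq_square mult.assoc\<close>)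
qed

text \<open>The relative trace to each quadratic subfield doubles two coordinates and kills the
  other two, which reduces the claim to integers of quadratic fields. Over \<open>sn\<close> and
  \<open>sk\<close> the residues 2 and 3 make the doubled coordinates integral; over
  \<open>sm\<close> only \<open>2 * a - 2 * b\<close> is obtained, which suffices since
  \<open>2 * a\<close> is known by then.\<close>

lemma almost_integral_coords_half:
  assumes ai: "almost_integral int_elts (elt a b c e)"
  shows "2 * a \<in> \<int>" "2 * b \<in> \<int>" "2 * c \<in> \<int>" "2 * e \<in> \<int>"
proof -
  have mod4: "(m' * n') mod 4 \<in> {2, 3}"
  proof -
    \<comment> \<open>As \<open>d\<close> is odd, \<open>d^2\<close> is 1 modulo 4; with
      \<open>d * m'\<close> also 1 modulo 4, \<open>m' * n'\<close> has the residue of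
      \<open>d * n'\<close>.\<close>
    have "(d mod 4) * (d mod 4) mod 4 = 1"
      using d_mod_4 by auto
    then have "(d * d) mod 4 = 1"
      by (simp add: mod_mult_eq)
    then have "(m' * n') mod 4 = ((d * d) mod 4 * ((m' * n') mod 4)) mod 4"
      by simp
    also have "\<dots> = ((d * m') mod 4 * ((d * n') mod 4)) mod 4"
      by (simp add: mod_mult_eq mult_ac)
    also have "\<dots> = (d * n') mod 4"
      by (simp add: m_mod_4)
    finally show ?thesis
      using n_mod_4 by simp
  qed
  have sqf: "squarefree (m' * n')"
    using squarefree_m squarefree_n coprime_m'_n'
    by (auto intro!: squarefree_mult_coprime dest: squarefree_multD)
  note sum = almost_integral_add[OF subring_int_elts]
  have c1: "almost_integral int_elts (elt a b (- c) (- e))"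
    and c2: "almost_integral int_elts (elt a (- b) c (- e))"
    and c3: "almost_integral int_elts (elt a (- b) (- c) e)"
    using almost_integral_conj[OF ai, of 1 "-1"] almost_integral_conj[OF ai, of "-1" 1]
      almost_integral_conj[OF ai, of "-1" "-1"] by simp_all
  have 1: "almost_integral int_elts (elt (2 * a) (2 * b) 0 0)"
    using sum[OF ai c1] by (simp add: elt_add)
  have 2: "almost_integral int_elts (elt (2 * a) 0 (2 * c) 0)"
    using sum[OF ai c2] by (simp add: elt_add)
  have 3: "almost_integral int_elts (elt (2 * a) 0 0 (2 * e))"
    using sum[OF ai c3] by (simp add: elt_add)
  \<comment> \<open>These are the conjugates of the two traces inside their quadratic fields, needed
    for trace and norm to the rationals.\<close>
  have c2': "almost_integral int_elts (elt (2 * a) 0 (- (2 * c)) 0)"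
    using almost_integral_conj[OF 2, of 1 "-1"] by simp
  have c3': "almost_integral int_elts (elt (2 * a) 0 0 (- (2 * e)))"
    using almost_integral_conj[OF 3, of 1 "-1"] by simp
  note q2 = almost_integral_quadratic[OF 2 c2', of "2 * a" "(2 * a)\<^sup>2 - of_int (d * n') * (2 * c)\<^sup>2"]
  note q3 = almost_integral_quadratic[OF 3 c3', of "2 * a" "(2 * a)\<^sup>2 - of_int (m' * n') * (2 * e)\<^sup>2"]
  have "2 * a \<in> \<int> \<and> 2 * c \<in> \<int>"
    by (rule quadratic_integer_coeffs(2)[OF squarefree_n _ _ n_mod_4])
      (use q2 in \<open>simp_all add: elt_add elt_mult power2_eq_square mult.assoc\<close>)
  then show a: "2 * a \<in> \<int>" and "2 * c \<in> \<int>"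
    by auto
  have "2 * a \<in> \<int> \<and> 2 * e \<in> \<int>"
    by (rule quadratic_integer_coeffs(2)[OF sqf _ _ mod4])
      (use q3 in \<open>simp_all add: elt_add elt_mult power2_eq_square mult.assoc\<close>)
  then show "2 * e \<in> \<int>"
    by auto
  have "2 * a - 2 * b \<in> \<int>"
    using almost_integral_K[OF 1] by simp
  then have "2 * a - (2 * a - 2 * b) \<in> \<int>"
    using a by (rule Ints_diff[rotated])
  then show "2 * b \<in> \<int>"
    by simp
qed

text \<open>The relative norm to \<open>K\<close> is an integer of \<open>K\<close>, so the
  difference of its two coordinates is an integer. Four times this difference is, modulo 4, the norm
  form \<open>(A - B)^2 - n * (C - E)^2\<close> with \<open>n = d * n'\<close> of residue 2 or 3, so
  \<open>A - B\<close> and \<open>C - E\<close> are even.\<close>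

lemma almost_integral_coords:
  assumes ai: "almost_integral int_elts (elt a b c e)"
  shows "2 * b \<in> \<int>" "2 * e \<in> \<int>" "a - b \<in> \<int>" "c - e \<in> \<int>"
proof -
  obtain A B C E where ABCE: "2 * a = of_int A" "2 * b = of_int B" "2 * c = of_int C" "2 * e = of_int E"
    using almost_integral_coords_half[OF ai] by (auto elim!: Ints_cases)
  then show "2 * b \<in> \<int>" "2 * e \<in> \<int>"
    by simp_all
  have half: "a = of_int A / 2" "b = of_int B / 2" "c = of_int C / 2" "e = of_int E / 2"
    using ABCE by simp_all
  \<comment> \<open>\<open>U\<close> and \<open>V\<close> are the coordinates of the relative norm
    at \<open>1\<close> and \<open>sm\<close>.\<close>
  define U where "U = a * a + of_int (d * m') * b * b - of_int (d * n') * c * c - of_int (m' * n') * e * e"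
  define V where "V = 2 * a * b - 2 * of_int n' * c * e"
  have "almost_integral int_elts (elt a b (- c) (- e))"
    using almost_integral_conj[OF ai, of 1 "-1"] by simp
  from almost_integral_mult[OF subring_int_elts ai this] have "almost_integral int_elts (elt U V 0 0)"
    by (simp add: elt_mult U_def V_def algebra_simps)
  then obtain z where z: "U - V = of_int z"
    using almost_integral_K by (auto elim!: Ints_cases)
  let ?Q = "A * A + d * m' * B * B - d * n' * C * C - m' * n' * E * E - 2 * A * B + 2 * n' * C * E"
  have "of_int ?Q = 4 * (U - V)"
    unfolding U_def V_def half by (simp add: field_simps)
  then have "of_int ?Q = (of_int (4 * z) :: rat)"
    unfolding z by simp
  then have Q: "?Q = 4 * z"
    by (simp only: of_int_eq_iff)
  obtain i where "d * m' = 4 * i + 1"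
    using m_mod_4 by (metis mult_div_mod_eq)
  then have i: "d * m' - 1 = 4 * i"
    by simp
  have "d mod 4 = m' mod 4"
    using d_mod_4 by auto
  then have "4 dvd d - m'"
    by (simp add: mod_eq_dvd_iff)
  then obtain j where j: "d - m' = 4 * j"
    by (rule dvdE)
  obtain l where l: "d - 1 = 2 * l"
    using odd_d_m'(1) by (auto elim: oddE)
  \<comment> \<open>The correction terms are multiples of 4 because \<open>d * m' - 1\<close> and
    \<open>d - m'\<close> are, and because \<open>d - 1\<close> is even.\<close>
  have "(A - B)\<^sup>2 - d * n' * (C - E)\<^sup>2 =
      ?Q - (d * m' - 1) * B * B - n' * (d - m') * E * E + (d - 1) * (2 * n' * C * E)"
    by (simp add: power2_eq_square algebra_simps)
  also have "\<dots> = 4 * z - (4 * i) * B * B - n' * (4 * j) * E * E + (2 * l) * (2 * n' * C * E)"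
    by (simp only: Q i j l)
  also have "\<dots> = 4 * (z - i * B * B - n' * j * E * E + l * n' * C * E)"
    by (simp add: algebra_simps)
  finally have "4 dvd (A - B)\<^sup>2 - d * n' * (C - E)\<^sup>2"
    by simp
  from even_of_norm_mod_4(2)[OF this n_mod_4] obtain p q where "A - B = 2 * p" "C - E = 2 * q"
    unfolding dvd_def by blast
  then have "a - b = of_int p" "c - e = of_int q"
    unfolding half by (simp_all add: field_simps flip: of_int_diff)
  then show "a - b \<in> \<int>" "c - e \<in> \<int>"
    by simp_all
qed

text \<open>The element with coordinates \<open>A, B, C, D\<close> in the integral basis
  \<open>1, (1 + sm) / 2, sn, (sn + sk) / 2\<close>.\<close>

definition int_elt :: "int \<Rightarrow> int \<Rightarrow> int \<Rightarrow> int \<Rightarrow> complex" where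
  "int_elt A B C D = elt (of_int A + of_int B / 2) (of_int B / 2) (of_int C + of_int D / 2) (of_int D / 2)"

lemma int_elt_eq_iff: "int_elt A B C D = int_elt A' B' C' D' \<longleftrightarrow> A = A' \<and> B = B' \<and> C = C' \<and> D = D'"
  by (auto simp: int_elt_def elt_eq_iff)

text \<open>Split the element as \<open>\<alpha> + \<eta>\<close> with \<open>\<alpha>\<close> in
  the span of \<open>1, sm\<close> and \<open>\<eta>\<close> in that of \<open>sn, sk\<close>. Both
  \<open>\<alpha>\<close> and \<open>\<eta>^2\<close> have integral coordinates in
  \<open>1, \<gamma>\<close>, so the element is a root of the monic quadratic
  \<open>X^2 - 2 * \<alpha> * X + (\<alpha>^2 - \<eta>^2)\<close>.\<close>

lemma algebraic_int_int_elt: "algebraic_int (int_elt A B C D)"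
proof -
  obtain i where i: "d * m' = 4 * i + 1"
    using m_mod_4 by (metis mult_div_mod_eq)
  obtain h where "g = 2 * h + 1"
    using odd_g by (rule oddE)
  then have h: "d + m' = 4 * h + 2"
    using two_g by simp
  define \<gamma> where "\<gamma> = (1 + sm) / 2"
  define \<alpha> \<eta> where "\<alpha> = of_int A + of_int B * \<gamma>" and "\<eta> = of_int C * sn + of_int D * (sn + sk) / 2"
  have x: "int_elt A B C D = \<alpha> + \<eta>"
    unfolding int_elt_def elt_def \<alpha>_def \<eta>_def \<gamma>_def
    by (simp add: of_rat_add of_rat_mult of_rat_divide field_simps)
  have "\<gamma>\<^sup>2 = (1 + 2 * sm + sm * sm) / 4"
    by (simp add: \<gamma>_def power2_eq_square field_simps)
  also have "\<dots> = \<gamma> + of_int i"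
    unfolding sqrt_mult i by (simp add: \<gamma>_def field_simps)
  finally have \<gamma>: "\<gamma>\<^sup>2 = \<gamma> + of_int i" .
  \<comment> \<open>The coordinates of \<open>\<eta>^2\<close> in \<open>1, \<gamma>\<close>; that
    \<open>d + m'\<close> is 2 modulo 4 makes \<open>S1\<close> an integer.\<close>
  define S1 S2 where "S1 = C\<^sup>2 * d * n' + C * D * n' * (d - 1) + D\<^sup>2 * n' * h"
    and "S2 = 2 * C * D * n' + D\<^sup>2 * n'"
  have "4 * \<eta>\<^sup>2 = of_int (4 * C\<^sup>2 + 4 * C * D + D\<^sup>2) * (sn * sn)
      + of_int (4 * C * D + 2 * D\<^sup>2) * (sn * sk) + of_int (D\<^sup>2) * (sk * sk)"
    by (simp add: \<eta>_def power2_eq_square field_simps)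
  also have "\<dots> = of_int ((4 * C\<^sup>2 + 4 * C * D) * d * n' + D\<^sup>2 * n' * (d + m'))
      + of_int ((4 * C * D + 2 * D\<^sup>2) * n') * sm"
    unfolding sqrt_mult by (simp add: algebra_simps)
  also have "\<dots> = 4 * (of_int S1 + of_int S2 * \<gamma>)"
    unfolding h S1_def S2_def by (simp add: \<gamma>_def field_simps)
  finally have \<eta>: "\<eta>\<^sup>2 = of_int S1 + of_int S2 * \<gamma>"
    by (simp only: mult_cancel_left) simp
  have "\<alpha>\<^sup>2 = of_int (A\<^sup>2) + of_int (2 * A * B) * \<gamma> + of_int (B\<^sup>2) * \<gamma>\<^sup>2"
    by (simp add: \<alpha>_def power2_eq_square algebra_simps)
  then have \<alpha>: "\<alpha>\<^sup>2 = of_int (A\<^sup>2 + B\<^sup>2 * i) + of_int (2 * A * B + B\<^sup>2) * \<gamma>"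
    unfolding \<gamma> by (simp add: algebra_simps)
  have "(\<alpha> + \<eta>)\<^sup>2 + (- 2 * \<alpha>) * (\<alpha> + \<eta>) + (\<alpha>\<^sup>2 - \<eta>\<^sup>2) = 0"
    by (simp add: power2_eq_square algebra_simps)
  moreover have "- 2 * \<alpha> = of_int (- 2 * A) + of_int (- 2 * B) * \<gamma>"
    by (simp add: \<alpha>_def algebra_simps)
  moreover have "\<alpha>\<^sup>2 - \<eta>\<^sup>2 = of_int (A\<^sup>2 + B\<^sup>2 * i - S1) + of_int (2 * A * B + B\<^sup>2 - S2) * \<gamma>"
    unfolding \<alpha> \<eta> by (simp add: algebra_simps)
  ultimately show ?thesis
    unfolding x by (intro algebraic_int_quadratic_tower[OF \<gamma>]) (simp only:)
qed

lemma elt_in_ring_of_integers_iff: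
  "elt a b c e \<in> ring_of_integers L \<longleftrightarrow> 2 * b \<in> \<int> \<and> 2 * e \<in> \<int> \<and> a - b \<in> \<int> \<and> c - e \<in> \<int>"
proof
  assume "elt a b c e \<in> ring_of_integers L"
  then have "almost_integral int_elts (elt a b c e)"
    by (intro algebraic_int_imp_almost_integral_elt) (simp_all add: ring_of_integers_def)
  then show "2 * b \<in> \<int> \<and> 2 * e \<in> \<int> \<and> a - b \<in> \<int> \<and> c - e \<in> \<int>"
    using almost_integral_coords by simp
next
  assume "2 * b \<in> \<int> \<and> 2 * e \<in> \<int> \<and> a - b \<in> \<int> \<and> c - e \<in> \<int>"
  then obtain A B C D where *: "2 * b = of_int B" "2 * e = of_int D" "a - b = of_int A" "c - e = of_int C"
    by (auto elim!: Ints_cases)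
  have "elt a b c e = int_elt A B C D"
    unfolding int_elt_def elt_eq_iff *[symmetric] by simp
  then show "elt a b c e \<in> ring_of_integers L"
    using algebraic_int_int_elt elt_in_L[of a b c e] unfolding ring_of_integers_def by simp
qed

lemma ring_of_integers_eq: "ring_of_integers L = {int_elt A B C D | A B C D. True}"
proof (intro equalityI subsetI)
  fix x
  assume x: "x \<in> ring_of_integers L"
  then obtain a b c e where abce: "x = elt a b c e"
    unfolding ring_of_integers_def by (blast elim: L_E)
  then obtain A B C D where *: "2 * b = of_int B" "2 * e = of_int D" "a - b = of_int A" "c - e = of_int C"
    using x unfolding abce elt_in_ring_of_integers_iff by (auto elim!: Ints_cases)
  have "x = int_elt A B C D"
    unfolding int_elt_def abce elt_eq_iff *[symmetric] by simp
  then show "x \<in> {int_elt A B C D | A B C D. True}"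
    by blast
qed (auto simp: int_elt_def elt_in_ring_of_integers_iff)

section \<open>The Hopf--Galois structure\<close>

text \<open>
  The factors \<open>m'\<close> and \<open>d\<close> normalise the parameter \<open>t\<close> so that it becomes an integer on the
  associated order.
\<close>

definition act :: "rat \<Rightarrow> rat \<Rightarrow> rat \<Rightarrow> rat \<Rightarrow> complex \<Rightarrow> complex" where
  "act p q r t = restrict (\<lambda>x. THE y. \<exists>a b c e. x = elt a b c e \<and>
     y = elt (p * a) (q * b) (r * c - t * of_int m' * e) (t * of_int d * c + r * e)) L"

lemma act_elt: "act p q r t (elt a b c e) =
    elt (p * a) (q * b) (r * c - t * of_int m' * e) (t * of_int d * c + r * e)"
  unfolding act_def by (auto simp: elt_in_L elt_eq_iff intro!: the_equality)

lemma act_eqI: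
  assumes "h \<in> extensional L"
    and "\<And>a b c e. h (elt a b c e) =
      elt (p * a) (q * b) (r * c - t * of_int m' * e) (t * of_int d * c + r * e)"
  shows "h = act p q r t"
proof (rule extensionalityI[OF assms(1)])
  show "act p q r t \<in> extensional L"
    by (simp add: act_def)
  fix x
  assume "x \<in> L"
  then obtain a b c e where "x = elt a b c e"
    by (rule L_E)
  then show "h x = act p q r t x"
    using assms(2) act_elt by simp
qed

lemma act_eq_iff: "act p q r t = act p' q' r' t' \<longleftrightarrow> p = p' \<and> q = q' \<and> r = r' \<and> t = t'"
proof
  assume "act p q r t = act p' q' r' t'"
  then have *: "act p q r t (elt a b c e) = act p' q' r' t' (elt a b c e)" for a b c e
    by simp
  show "p = p' \<and> q = q' \<and> r = r' \<and> t = t'"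
    \<comment> \<open>At \<open>1 + sm + sn\<close> the value has the coordinates
      \<open>p, q, r, t * d\<close>, which reveal all parameters.\<close>
    using *[of 1 1 1 0] d_pos unfolding act_elt elt_eq_iff by simp
qed simp

section \<open>The generators \<open>\<sigma>\<close> and \<open>\<tau>\<close>\<close>

lemma galois_group_fixing_K:
  assumes "f \<in> carrier (galois_group \<rat> L)" "f sm = sm"
  shows "f \<in> carrier (galois_group K L)"
proof -
  obtain t where t: "f sn = of_rat t * sn"
    using galois_signs[OF assms(1)] by blast
  have "f x = x" if xK: "x \<in> K" for x
  proof -
    obtain a b where "x = of_rat a + of_rat b * sm"
      using xK unfolding K_def by (auto elim!: Rats_cases)
    then have "x = elt a b 0 0"
      by (simp add: elt_def)
    then show ?thesis
      using galois_elt[OF assms(1) _ t, of 1 a b 0 0] assms(2) by simp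
  qed
  then show ?thesis
    using assms(1) by (auto simp: galois_group_simps)
qed

lemma galois_group_K_subset:
  assumes "f \<in> carrier (galois_group K L)"
  shows "f \<in> carrier (galois_group \<rat> L)" "f sm = sm"
proof -
  have "sm \<in> K"
    unfolding K_eq rat_adjoin_def by (rule hull_inc) simp
  then show "f sm = sm"
    using assms by (auto simp: galois_group_simps)
  show "f \<in> carrier (galois_group \<rat> L)"
    using assms subfield_of_complex_Rats_subset[OF subfield_K] by (auto simp: galois_group_simps)
qed

text \<open>Serves to exclude the identity as a generator of the Galois group over
  \<open>K\<close>.\<close>

lemma generate_one: "generate (galois_group K L) {\<lambda>x\<in>L. x} \<subseteq> {\<lambda>x\<in>L. x}"
proof
  let ?G = "galois_group K L"
  let ?id = "\<lambda>x\<in>L. x"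
  have mult: "?id \<otimes>\<^bsub>?G\<^esub> y = y" "y \<otimes>\<^bsub>?G\<^esub> ?id = y" if "y \<in> carrier ?G" for y
    using that Id_compose[of y L L] compose_Id[of y L L]
    by (auto simp: galois_group_simps id_Bij Bij_imp_extensional Bij_imp_funcset)
  have closed: "x + y \<in> L" "x * y \<in> L" if "x \<in> L" "y \<in> L" for x y
    using that subfield_of_complexD(3,4)[OF subfield_L] by auto
  have "K \<subseteq> L"
    unfolding K_eq L_def rat_adjoin_def by (intro hull_mono) auto
  then have id: "?id \<in> carrier ?G"
    using closed by (auto simp: galois_group_simps id_Bij)
  have inv: "inv\<^bsub>?G\<^esub> ?id = ?id"
    unfolding m_inv_def galois_group_simps(2)
    by (rule the_equality) (use mult id in auto)
  fix f
  assume "f \<in> generate ?G {?id}"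
  then show "f \<in> {?id}"
    by (induction rule: generate.induct)
      (simp_all only: singleton_iff galois_group_simps(2) inv mult(1)[OF id])
qed

text \<open>\<open>\<tau>\<close> fixes \<open>sm\<close> and is not the identity, so it negates
  \<open>sn\<close>; \<open>\<sigma>\<close> does not fix \<open>K\<close>, so it negates
  \<open>sm\<close>. The remaining sign \<open>\<epsilon>\<close> reflects the choice between
  \<open>\<sigma>\<close> and \<open>\<sigma>\<tau>\<close>.\<close>

lemma nonclassical_generators:
  assumes gen: "generate (galois_group K L) {\<tau>} = carrier (galois_group K L)"
    and \<sigma>: "\<sigma> \<in> carrier (galois_group \<rat> L) - carrier (galois_group K L)"
  obtains \<epsilon> where "\<epsilon> \<in> {1, -1}"
    "\<And>a b c e. \<tau> (elt a b c e) = elt a b (- c) (- e)"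
    "\<And>a b c e. \<sigma> (elt a b c e) = elt a (- b) (\<epsilon> * c) (- \<epsilon> * e)"
proof -
  have "\<tau> \<in> carrier (galois_group K L)"
    using generate.incl[of \<tau> "{\<tau>}" "galois_group K L"] gen by simp
  note \<tau> = galois_group_K_subset[OF this]
  obtain t where t: "t \<in> {1, -1}" "\<tau> sn = of_rat t * sn"
    using galois_signs[OF \<tau>(1)] by blast
  have "t \<noteq> 1"
  proof
    assume "t = 1"
    have "\<tau> = (\<lambda>x\<in>L. x)"
    proof (rule extensionalityI[of _ L])
      show "\<tau> \<in> extensional L"
        using \<tau>(1) by (auto simp: galois_group_simps Bij_def)
      fix x
      assume "x \<in> L"
      then obtain a b c e where "x = elt a b c e"
        by (rule L_E)
      then show "\<tau> x = (\<lambda>x\<in>L. x) x"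
        using galois_elt[OF \<tau>(1) _ t(2), of 1 a b c e] \<tau>(2) \<open>t = 1\<close> elt_in_L[of a b c e] by simp
    qed simp
    then have trivial: "f = (\<lambda>x\<in>L. x)" if "f \<in> carrier (galois_group K L)" for f
      using that generate_one gen by auto
    \<comment> \<open>The automorphism fixing \<open>sm\<close> and negating \<open>sn\<close> is a
      non-trivial element over \<open>K\<close>, which a trivial \<open>\<tau>\<close> cannot
      generate.\<close>
    obtain f where f: "f \<in> carrier (galois_group \<rat> L)" "f sm = of_rat 1 * sm" "f sn = of_rat (- 1) * sn"
      using galois_exists[of 1 "- 1"] by auto
    have "f sn = sn"
      using trivial[OF galois_group_fixing_K[OF f(1)]] f(2) in_L(3) by simp
    then have "sn = 0"
      using f(3) by (simp add: of_rat_minus)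
    then show False
      using sn_notin_K subfield_of_complexD(1)[OF subfield_K] by simp
  qed
  then have \<tau>_elt: "\<tau> (elt a b c e) = elt a b (- c) (- e)" for a b c e
    using galois_elt[OF \<tau>(1) _ t(2), of 1 a b c e] \<tau>(2) t(1) by simp
  have \<sigma>_gal: "\<sigma> \<in> carrier (galois_group \<rat> L)"
    using \<sigma> by simp
  obtain s \<epsilon> where s: "s \<in> {1, -1}" "\<epsilon> \<in> {1, -1}" "\<sigma> sm = of_rat s * sm" "\<sigma> sn = of_rat \<epsilon> * sn"
    using galois_signs[OF \<sigma>_gal] by blast
  have "s \<noteq> 1"
    using s(3) \<sigma> galois_group_fixing_K[OF \<sigma>_gal] by auto
  then have "\<sigma> (elt a b c e) = elt a (- b) (\<epsilon> * c) (- \<epsilon> * e)" for a b c e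
    using galois_elt[OF \<sigma>_gal s(3,4), of a b c e] s(1) by simp
  with s(2) \<tau>_elt show ?thesis
    using that by blast
qed

lemma sm_mult_elt: "sm * elt a b c e = elt (of_int (d * m') * b) a (of_int m' * e) (of_int d * c)"
  using elt_mult[of 0 1 0 0 a b c e] sm_eq_elt by simp

lemma hopf_galois_eq_act:
  assumes "nonclassical_hopf_galois L sm H"
  shows "H = {act p q r t | p q r t. True}"
proof -
  obtain \<sigma> \<tau> where gen: "generate (galois_group K L) {\<tau>} = carrier (galois_group K L)"
    and \<sigma>: "\<sigma> \<in> carrier (galois_group \<rat> L) - carrier (galois_group K L)"
    and H: "H = nonclassical_algebra L sm \<sigma> \<tau>"
    using assms unfolding nonclassical_hopf_galois_def K_eq by blast
  obtain \<epsilon> where \<epsilon>: "\<epsilon> \<in> {1, -1}"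
    and \<tau>_elt: "\<And>a b c e. \<tau> (elt a b c e) = elt a b (- c) (- e)"
    and \<sigma>_elt: "\<And>a b c e. \<sigma> (elt a b c e) = elt a (- b) (\<epsilon> * c) (- \<epsilon> * e)"
    using nonclassical_generators[OF gen \<sigma>] by blast
  let ?h = "\<lambda>a b c e. \<lambda>x\<in>L. of_rat a * x + of_rat b * \<tau> x + of_rat c * (\<sigma> x + compose L \<sigma> \<tau> x)
            + of_rat e * (sm * (\<sigma> x - compose L \<sigma> \<tau> x))"
  \<comment> \<open>The element \<open>\<sigma> + \<sigma>\<tau>\<close> is 2 on \<open>1\<close>,
    -2 on \<open>sm\<close> and 0 on \<open>sn, sk\<close>. The element
    \<open>sm * (\<sigma> - \<sigma>\<tau>)\<close> kills \<open>1, sm\<close> and is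
    \<open>2 * \<epsilon>\<close> times the map \<open>T\<close> on \<open>sn, sk\<close>.\<close>
  have h: "?h a b c e = act (a + b + 2 * c) (a + b - 2 * c) (a - b) (2 * \<epsilon> * e)" for a b c e
  proof (rule act_eqI)
    fix a' b' c' e'
    show "?h a b c e (elt a' b' c' e') = elt ((a + b + 2 * c) * a') ((a + b - 2 * c) * b')
      ((a - b) * c' - 2 * \<epsilon> * e * of_int m' * e') (2 * \<epsilon> * e * of_int d * c' + (a - b) * e')"
      by (simp add: elt_in_L compose_eq \<tau>_elt \<sigma>_elt elt_diff elt_add sm_mult_elt of_rat_mult_elt
          elt_eq_iff algebra_simps)
  qed simp
  \<comment> \<open>The linear change of parameters is inverted, using
    \<open>\<epsilon>^2 = 1\<close>.\<close>
  have "act p q r t = ?h (((p + q) / 2 + r) / 2) (((p + q) / 2 - r) / 2) ((p - q) / 4) (\<epsilon> * t / 2)" for p q r t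
    unfolding h act_eq_iff using \<epsilon> by (auto simp: field_simps)
  then show ?thesis
    unfolding H nonclassical_algebra_def using h by fast
qed

text \<open>A common divisor of \<open>d\<close> and \<open>g\<close> divides
  \<open>m' = 2 * g - d\<close>, whereas \<open>d\<close> and \<open>m'\<close> are coprime because
  \<open>d * m'\<close> is squarefree. The factor 2 is harmless as \<open>g\<close> is odd.\<close>

lemma coprime_2d_g: "coprime (2 * d) g"
proof -
  have "coprime d m'"
  proof (rule coprimeI)
    fix c
    assume "c dvd d" "c dvd m'"
    then have "c\<^sup>2 dvd d * m'"
      unfolding power2_eq_square by (rule mult_dvd_mono)
    then show "is_unit c"
      by (rule squarefreeD[OF squarefree_m])
  qed
  moreover have "m' = 2 * g - 1 * d"
    using two_g by simp
  ultimately have "coprime d g"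
    by (metis coprime_def dvd_diff dvd_mult)
  then show ?thesis
    using odd_g by (simp add: coprime_commute)
qed

text \<open>The form \<open>q + 2 * s\<close> encodes that the eigenvalues on \<open>1\<close> and
  \<open>sm\<close> are congruent modulo 2, the condition for a diagonal map to preserve the span of
  \<open>1\<close> and \<open>(1 + sm) / 2\<close>.\<close>

definition order_elt :: "int \<Rightarrow> int \<Rightarrow> int \<Rightarrow> int \<Rightarrow> complex \<Rightarrow> complex" where
  "order_elt q s r t = act (of_int (q + 2 * s)) (of_int q) (of_int r) (of_int t)"

text \<open>For fixed \<open>A, B, C, D\<close> this is linear in \<open>(q, s)\<close> and in
  \<open>(r, t)\<close> separately; the term \<open>0 * s\<close> keeps the matrix shape of
  \<open>bij_int_matrix_iff\<close>.\<close>

lemma order_elt_int_elt: "order_elt q s r t (int_elt A B C D) =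
    int_elt (A * q + (2 * A + B) * s) (B * q + 0 * s)
      (C * r + (- (d * C + g * D)) * t) (D * r + (2 * d * C + d * D) * t)"
  unfolding order_elt_def int_elt_def act_elt elt_eq_iff by (simp add: of_int_g field_simps)

lemma associated_order_eq:
  assumes "nonclassical_hopf_galois L sm H"
  shows "associated_order L H = {order_elt q s r t | q s r t. True}"
proof (intro equalityI subsetI)
  fix h
  assume "h \<in> {order_elt q s r t | q s r t. True}"
  then show "h \<in> associated_order L H"
    unfolding associated_order_def hopf_galois_eq_act[OF assms] ring_of_integers_eq
    by (auto simp: order_elt_int_elt) (auto simp: order_elt_def)
next
  fix h
  assume h: "h \<in> associated_order L H"
  then obtain p q r t where hact: "h = act p q r t"
    unfolding associated_order_def hopf_galois_eq_act[OF assms] by blast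
  have "int_elt A B C D \<in> ring_of_integers L" for A B C D
    unfolding ring_of_integers_eq by blast
  then have *: "h (int_elt A B C D) \<in> ring_of_integers L" for A B C D
    using h unfolding associated_order_def by blast
  \<comment> \<open>Integrality of the images of the first three basis elements.\<close>
  have ints: "p \<in> \<int>" "q \<in> \<int>" "p / 2 - q / 2 \<in> \<int>" "2 * (t * of_int d) \<in> \<int>" "r - t * of_int d \<in> \<int>"
    using *[of 1 0 0 0] *[of 0 1 0 0] *[of 0 0 1 0]
    unfolding hact int_elt_def act_elt elt_in_ring_of_integers_iff by simp_all
  \<comment> \<open>The image of \<open>(sn + sk) / 2\<close> shows that \<open>t * g\<close> is an
    integer.\<close>
  have "(r / 2 - t * of_int m' / 2) - (t * of_int d / 2 + r / 2) \<in> \<int>"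
    using *[of 0 0 0 1] unfolding hact int_elt_def act_elt elt_in_ring_of_integers_iff by simp
  moreover have "(r / 2 - t * of_int m' / 2) - (t * of_int d / 2 + r / 2) = - (t * of_int g)"
    by (simp add: of_int_g field_simps)
  ultimately have tg: "- (t * of_int g) \<in> \<int>"
    by simp
  \<comment> \<open>Both \<open>t * 2 * d\<close> and \<open>t * g\<close> are integers, so a Bezout
    relation makes \<open>t\<close> an integer.\<close>
  obtain u v where "u * (2 * d) + v * g = gcd (2 * d) g"
    using bezout_int[of "2 * d" g] by blast
  then have "u * (2 * d) + v * g = 1"
    using coprime_2d_g by (simp only: coprime_iff_gcd_eq_1)
  from arg_cong[OF this, of "of_int :: int \<Rightarrow> rat"]
  have "of_int u * (2 * of_int d) + of_int v * of_int g = (1 :: rat)"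
    by simp
  then have "t = t * (of_int u * (2 * of_int d) + of_int v * of_int g)"
    by simp
  also have "\<dots> = of_int u * (2 * (t * of_int d)) - of_int v * (- (t * of_int g))"
    by (simp add: algebra_simps)
  also have "\<dots> \<in> \<int>"
    by (rule Ints_diff[OF Ints_mult[OF Ints_of_int ints(4)] Ints_mult[OF Ints_of_int tg]])
  finally have "t \<in> \<int>" .
  moreover have "r - t * of_int d + t * of_int d \<in> \<int>"
    using ints(5) \<open>t \<in> \<int>\<close> by (intro Ints_add Ints_mult) auto
  ultimately obtain q' s r' t' where "q = of_int q'" "p / 2 - q / 2 = of_int s" "r = of_int r'" "t = of_int t'"
    using ints by (auto elim!: Ints_cases)
  then have "h = order_elt q' s r' t'"
    unfolding hact order_elt_def act_eq_iff by (auto simp: field_simps)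
  then show "h \<in> {order_elt q s r t | q s r t. True}"
    by blast
qed

section \<open>Free generators\<close>

text \<open>Through the integral parametrisations \<open>\<phi>\<close> and \<open>\<psi>\<close>,
  evaluation at the element becomes a block diagonal endomorphism of \<open>Z^4\<close>, which is
  bijective iff both block determinants are units.\<close>

lemma free_generator_iff:
  assumes "nonclassical_hopf_galois L sm H"
  shows "free_generator (associated_order L H) (ring_of_integers L) (int_elt A B C D) \<longleftrightarrow>
    \<bar>B * (2 * A + B)\<bar> = 1 \<and> \<bar>2 * d * C\<^sup>2 + 2 * d * C * D + g * D\<^sup>2\<bar> = 1"
proof -
  let ?\<beta> = "int_elt A B C D" and ?O = "ring_of_integers L" and ?A = "associated_order L H"
  define \<phi> where "\<phi> = (\<lambda>((q, s), (r, t)). order_elt q s r t)"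
  define \<psi> where "\<psi> = (\<lambda>((A, B), (C, D)). int_elt A B C D)"
  let ?M1 = "\<lambda>(q, s). (A * q + (2 * A + B) * s, B * q + 0 * s)"
  let ?M2 = "\<lambda>(r, t). (C * r + (- (d * C + g * D)) * t, D * r + (2 * d * C + d * D) * t)"
  have "range \<phi> = ?A" "range \<psi> = ?O"
    unfolding associated_order_eq[OF assms] ring_of_integers_eq
    by (auto simp: \<phi>_def \<psi>_def image_def)
  moreover have "inj \<phi>" "inj \<psi>"
    by (auto simp: inj_def \<phi>_def \<psi>_def order_elt_def act_eq_iff int_elt_eq_iff)
  ultimately have \<phi>: "bij_betw \<phi> UNIV ?A" and \<psi>: "bij_betw \<psi> UNIV ?O"
    by (auto simp: bij_betw_def)
  have comp: "(\<lambda>h. h ?\<beta>) \<circ> \<phi> = \<psi> \<circ> map_prod ?M1 ?M2"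
    by (auto simp: fun_eq_iff \<phi>_def \<psi>_def order_elt_int_elt)
  have "?\<beta> \<in> ?O"
    unfolding ring_of_integers_eq by blast
  then have "free_generator ?A ?O ?\<beta> \<longleftrightarrow> bij_betw (\<lambda>h. h ?\<beta>) ?A ?O"
    by (simp add: free_generator_def)
  also have "\<dots> \<longleftrightarrow> bij_betw ((\<lambda>h. h ?\<beta>) \<circ> \<phi>) UNIV ?O"
    by (rule bij_betw_comp_iff[OF \<phi>])
  also have "\<dots> \<longleftrightarrow> bij (map_prod ?M1 ?M2)"
    unfolding comp by (rule bij_betw_comp_iff2[OF \<psi>, symmetric]) simp
  also have "\<dots> \<longleftrightarrow> \<bar>A * 0 - (2 * A + B) * B\<bar> = 1 \<and>
      \<bar>C * (2 * d * C + d * D) - (- (d * C + g * D)) * D\<bar> = 1"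
    unfolding bij_map_prod_iff bij_int_matrix_iff ..
  also have "A * 0 - (2 * A + B) * B = - (B * (2 * A + B))"
    by simp
  also have "C * (2 * d * C + d * D) - (- (d * C + g * D)) * D = 2 * d * C\<^sup>2 + 2 * d * C * D + g * D\<^sup>2"
    by (simp add: power2_eq_square algebra_simps)
  finally show ?thesis
    by simp
qed

section \<open>The norm equation\<close>

lemma norm_eq: "(d * (2 * C + D))\<^sup>2 + d * m' * D\<^sup>2 = 2 * d * (2 * d * C\<^sup>2 + 2 * d * C * D + g * D\<^sup>2)"
proof -
  have "2 * d * (2 * d * C\<^sup>2 + 2 * d * C * D + g * D\<^sup>2) = d * (4 * d * C\<^sup>2 + 4 * d * C * D + (2 * g) * D\<^sup>2)"
    by (simp add: algebra_simps)
  then show ?thesis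
    unfolding two_g by (simp add: power2_eq_square algebra_simps)
qed

lemma norm_pm_2d_iff:
  "(d * (2 * C + D))\<^sup>2 + d * m' * D\<^sup>2 = 2 * d \<or> (d * (2 * C + D))\<^sup>2 + d * m' * D\<^sup>2 = - (2 * d) \<longleftrightarrow>
   \<bar>2 * d * C\<^sup>2 + 2 * d * C * D + g * D\<^sup>2\<bar> = 1"
proof -
  define Q where "Q = 2 * d * C\<^sup>2 + 2 * d * C * D + g * D\<^sup>2"
  have "2 * d * Q = 2 * d \<longleftrightarrow> Q = 1" "2 * d * Q = - (2 * d) \<longleftrightarrow> Q = - 1"
    using d_pos mult_cancel_left[of "2 * d" Q 1] mult_cancel_left[of "2 * d" Q "- 1"] by auto
  then show ?thesis
    unfolding norm_eq Q_def[symmetric] by auto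
qed

text \<open>Guarantees that \<open>(x - d * y) / (2 * d)\<close> is an integer. The squarefree
  \<open>d\<close> divides \<open>x^2\<close>, hence \<open>x = d * z\<close>; since
  \<open>d\<close> and \<open>m'\<close> are odd and the right-hand side is even, \<open>z\<close>
  and \<open>y\<close> have equal parity.\<close>

lemma norm_pm_2d_imp:
  assumes "x\<^sup>2 + d * m' * y\<^sup>2 = 2 * d \<or> x\<^sup>2 + d * m' * y\<^sup>2 = - (2 * d)"
  obtains C where "x = d * (2 * C + y)"
proof -
  have "d dvd x\<^sup>2 + d * (m' * y\<^sup>2)"
    using assms by (auto simp: mult.assoc)
  then have "d dvd x\<^sup>2"
    by (simp add: dvd_add_left_iff)
  moreover have "squarefree d"
    using squarefree_m by (rule squarefree_multD)
  ultimately have "d dvd x"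
    by (rule squarefree_dvd_square_imp_dvd[rotated])
  then obtain z where z: "x = d * z"
    by (rule dvdE)
  have "even (x\<^sup>2 + d * m' * y\<^sup>2)"
    using assms by (elim disjE) (simp_all only: dvd_triv_left dvd_minus_iff)
  then have "even (z - y)"
    using odd_d_m' by (auto simp: z)
  then obtain C where "z - y = 2 * C"
    by (rule evenE)
  then have "x = d * (2 * C + y)"
    by (simp add: z)
  then show ?thesis
    by (rule that)
qed

lemma free_generator_of_norm:
  assumes H: "nonclassical_hopf_galois L sm H"
    and xy: "x\<^sup>2 + d * m' * y\<^sup>2 = 2 * d \<or> x\<^sup>2 + d * m' * y\<^sup>2 = - (2 * d)"
  shows "free_generator (associated_order L H) (ring_of_integers L)
    (1 - (1 + sm) / 2 + of_int (x - d * y) / of_int (2 * d) * sn + of_int y * ((sn + sk) / 2))"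
    (is "free_generator _ _ ?\<beta>")
proof -
  obtain C where C: "x = d * (2 * C + y)"
    using norm_pm_2d_imp[OF xy] .
  then have "x - d * y = 2 * d * C"
    by (simp add: algebra_simps)
  then have "of_int (x - d * y) / of_int (2 * d) = (of_int C :: complex)"
    using d_pos by (simp del: of_int_diff)
  \<comment> \<open>With \<open>A = 1\<close> and \<open>B = - 1\<close> the first determinant
    condition holds, as \<open>B * (2 * A + B) = - 1\<close>.\<close>
  then have "?\<beta> = int_elt 1 (- 1) C y"
    by (simp add: int_elt_def elt_def of_rat_add of_rat_mult of_rat_minus of_rat_divide field_simps)
  moreover have "\<bar>2 * d * C\<^sup>2 + 2 * d * C * y + g * y\<^sup>2\<bar> = 1"
    using xy unfolding C norm_pm_2d_iff .
  ultimately show ?thesis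
    by (simp add: free_generator_iff[OF H])
qed

lemma free_of_rank_one_iff:
  assumes H: "nonclassical_hopf_galois L sm H"
  shows "free_of_rank_one (associated_order L H) (ring_of_integers L) \<longleftrightarrow>
    (\<exists>x y. x\<^sup>2 + d * m' * y\<^sup>2 = 2 * d \<or> x\<^sup>2 + d * m' * y\<^sup>2 = - (2 * d))"
proof
  assume "free_of_rank_one (associated_order L H) (ring_of_integers L)"
  then obtain \<beta> where \<beta>: "free_generator (associated_order L H) (ring_of_integers L) \<beta>"
    unfolding free_of_rank_one_def by blast
  then obtain A B C D where "\<beta> = int_elt A B C D"
    unfolding free_generator_def ring_of_integers_eq by blast
  then have "\<bar>2 * d * C\<^sup>2 + 2 * d * C * D + g * D\<^sup>2\<bar> = 1"
    using \<beta> free_generator_iff[OF H] by simp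
  \<comment> \<open>The solution read off from a generator is \<open>x = d * (2 * C + D)\<close>,
    \<open>y = D\<close>.\<close>
  then show "\<exists>x y. x\<^sup>2 + d * m' * y\<^sup>2 = 2 * d \<or> x\<^sup>2 + d * m' * y\<^sup>2 = - (2 * d)"
    unfolding norm_pm_2d_iff[symmetric] by blast
next
  assume "\<exists>x y. x\<^sup>2 + d * m' * y\<^sup>2 = 2 * d \<or> x\<^sup>2 + d * m' * y\<^sup>2 = - (2 * d)"
  then obtain x y where xy: "x\<^sup>2 + d * m' * y\<^sup>2 = 2 * d \<or> x\<^sup>2 + d * m' * y\<^sup>2 = - (2 * d)"
    by blast
  then show "free_of_rank_one (associated_order L H) (ring_of_integers L)"
    using free_generator_of_norm[OF H xy] unfolding free_of_rank_one_def by blast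
qed

end

theorem proposition5p5:
  fixes m n d k :: int
    and sm sn sk :: complex
    and L :: "complex set"
    and H :: "(complex \<Rightarrow> complex) set"
  assumes "squarefree m" and "squarefree n"
    and "m mod 4 = 1" and "n mod 4 = 2 \<or> n mod 4 = 3"
    and "d = gcd m n" and "k = m * n div d\<^sup>2"
    and "sm\<^sup>2 = of_int m" and "sn\<^sup>2 = of_int n"
    and "sk\<^sup>2 = of_int k" and "sk = sm * sn / of_int d"
    and "L = rat_adjoin {sm, sn}" and "biquadratic L"
    and "nonclassical_hopf_galois L sm H"
  shows "(free_of_rank_one (associated_order L H) (ring_of_integers L) \<longleftrightarrow>
            (\<exists>x y :: int. x\<^sup>2 + m * y\<^sup>2 = 2 * d \<or> x\<^sup>2 + m * y\<^sup>2 = - (2 * d))) \<and>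
         (\<forall>x y :: int. x\<^sup>2 + m * y\<^sup>2 = 2 * d \<or> x\<^sup>2 + m * y\<^sup>2 = - (2 * d) \<longrightarrow>
            (let \<gamma>\<^sub>1 = 1;
                 \<gamma>\<^sub>2 = (1 + sm) / 2;
                 \<gamma>\<^sub>3 = sn;
                 \<gamma>\<^sub>4 = (sn + sk) / 2;
                 \<beta> = \<gamma>\<^sub>1 - \<gamma>\<^sub>2 + of_int (x - d * y) / of_int (2 * d) * \<gamma>\<^sub>3 + of_int y * \<gamma>\<^sub>4
             in free_generator (associated_order L H) (ring_of_integers L) \<beta>))"
proof -
  have "m \<noteq> 0"
    using assms(1) by auto
  then have "d > 0"
    using assms(5) by simp
  obtain m' n' where "m = m' * gcd m n" "n = n' * gcd m n" "coprime m' n'"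
    using gcd_coprime_exists[of m n] \<open>m \<noteq> 0\<close> by auto
  then have m: "m = d * m'" and n: "n = d * n'" and "coprime m' n'"
    unfolding assms(5)[symmetric] by (simp_all add: mult.commute)
  interpret biquadratic_field d m' n' sm sn sk L
    by unfold_locales (use assms(1-4,7,8,10-12) \<open>d > 0\<close> \<open>coprime m' n'\<close> in \<open>auto simp: m[symmetric] n[symmetric]\<close>)
  show ?thesis
    unfolding Let_def m using free_of_rank_one_iff[OF assms(13)] free_generator_of_norm[OF assms(13)]
    by blast
qed

end
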